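(* Let $\Gamma$ be a finite, simple graph of diameter at least 3 and $V$ its vertex set. For each $v \in V$ let $G_v$ be a nontrivial, orderable group with generating set $\phi(Y_v)$ for a finite set $Y_v$, and let $X = \bigsqcup_{v \in V} (Y_v \sqcup Y_v^{-1})$. Let $G_\Gamma$ be the associated graph product group, and suppose that the monoid homomorphism $\phi : X^* \to G_\Gamma$ (which maps each $Y_v$ to a generating set of the vertex subgroup $G_v \leq G_\Gamma$) has the property that $\phi(x^{-1}) = \phi(x)^{-1}$ for all $x \in X$. Let $\mathrm{Geo} \subseteq X^*$ be the language of all geodesics for $G_\Gamma$ with respect to $X$. Then there exists no order $\leq$ on $G_\Gamma$ such that the positive cone language \[ \mathrm{Geo}_+ = \{\, w \in \mathrm{Geo} \mid w \text{ represents a positive element in } G_\Gamma \,\} \] is regular.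
   Context: An order on a group $G$ means a total left order: a total order $\leq$ on $G$ such that $g \leq g'$ implies $hg \leq hg'$ for all $g, g', h \in G$. A group is orderable if it admits an order. An element $g$ of an ordered group is positive if $e < g$, where $e$ is the identity. The graph product $G_\Gamma$ of the groups $G_v$ ($v \in V$) over $\Gamma$ is the quotient of the free product of all the $G_v$ by the relations $gh = hg$ for all $g \in G_v$, $h \in G_{v'}$ whenever $v$ and $v'$ are adjacent in $\Gamma$ (edges represent commuting relations). Each $G_v$ embeds in $G_\Gamma$ and is regarded as a subgroup. The diameter of $\Gamma$ is the supremum of the distances between pairs of vertices. $Y_v^{-1}$ denotes a set of formal inverses of the letters of $Y_v$, and $(x^{-1})^{-1}=x$ for letters. $X^*$ is the free monoid on $X$. A word $w \in X^*$ represents the element $\phi(w)$. A word $w \in X^*$ is a geodesic if no shorter word over $X$ represents the same element $\phi(w)$ of $G_\Gamma$. A language (subset of $X^*$) is regular if it is accepted by a finite state automaton. *)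

theory Defs
  imports "HOL-Algebra.Coset" "HOL-Algebra.Generated_Groups" "Graph_Theory.Graph_Theory"
begin

section \<open>Left orders on groups\<close>

definition left_order :: "('g, 'b) monoid_scheme \<Rightarrow> 'g rel \<Rightarrow> bool" where
  "left_order G r \<longleftrightarrow> linear_order_on (carrier G) r \<and>
     (\<forall>g\<in>carrier G. \<forall>g'\<in>carrier G. \<forall>h\<in>carrier G.
        (g, g') \<in> r \<longrightarrow> (h \<otimes>\<^bsub>G\<^esub> g, h \<otimes>\<^bsub>G\<^esub> g') \<in> r)"

definition orderable :: "('g, 'b) monoid_scheme \<Rightarrow> bool" where
  "orderable G \<longleftrightarrow> (\<exists>r. left_order G r)"

definition positive_element :: "('g, 'b) monoid_scheme \<Rightarrow> 'g rel \<Rightarrow> 'g \<Rightarrow> bool" where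
  "positive_element G r g \<longleftrightarrow> (\<one>\<^bsub>G\<^esub>, g) \<in> r \<and> g \<noteq> \<one>\<^bsub>G\<^esub>"


section \<open>Diameter of a graph\<close>

text \<open>Every edge has weight 1. The values are extended reals, so the distance between vertices
  in different components, and hence the diameter of a disconnected graph, is \<open>\<infinity>\<close>.\<close>

definition graph_dist :: "'v pair_pre_digraph \<Rightarrow> 'v \<Rightarrow> 'v \<Rightarrow> ereal" where
  "graph_dist \<Gamma> u v = wf_digraph.\<mu> (with_proj \<Gamma>) (\<lambda>_. 1) u v"

definition graph_diameter :: "'v pair_pre_digraph \<Rightarrow> ereal" where
  "graph_diameter \<Gamma> = (SUP (u, v) \<in> pverts \<Gamma> \<times> pverts \<Gamma>. graph_dist \<Gamma> u v)"


section \<open>Free products\<close>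

definition syllable_words :: "'v set \<Rightarrow> ('v \<Rightarrow> ('a, 'b) monoid_scheme) \<Rightarrow> ('v \<times> 'a) list set" where
  "syllable_words V G = lists (SIGMA v:V. carrier (G v))"

text \<open>The congruence on words over the disjoint union of the groups whose quotient is the
  free product.\<close>

inductive_set free_product_rel ::
    "'v set \<Rightarrow> ('v \<Rightarrow> ('a, 'b) monoid_scheme) \<Rightarrow> ('v \<times> 'a) list rel"
  for V :: "'v set" and G :: "'v \<Rightarrow> ('a, 'b) monoid_scheme" where
  refl: "w \<in> syllable_words V G \<Longrightarrow> (w, w) \<in> free_product_rel V G"
| sym: "(u, w) \<in> free_product_rel V G \<Longrightarrow> (w, u) \<in> free_product_rel V G"
| trans: "(u, v) \<in> free_product_rel V G \<Longrightarrow> (v, w) \<in> free_product_rel V G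
    \<Longrightarrow> (u, w) \<in> free_product_rel V G"
| one: "u \<in> syllable_words V G \<Longrightarrow> w \<in> syllable_words V G \<Longrightarrow> v \<in> V
    \<Longrightarrow> (u @ [(v, \<one>\<^bsub>G v\<^esub>)] @ w, u @ w) \<in> free_product_rel V G"
| mult: "u \<in> syllable_words V G \<Longrightarrow> w \<in> syllable_words V G \<Longrightarrow> v \<in> V
    \<Longrightarrow> g \<in> carrier (G v) \<Longrightarrow> h \<in> carrier (G v)
    \<Longrightarrow> (u @ [(v, g), (v, h)] @ w, u @ [(v, g \<otimes>\<^bsub>G v\<^esub> h)] @ w) \<in> free_product_rel V G"

definition free_product ::
    "'v set \<Rightarrow> ('v \<Rightarrow> ('a, 'b) monoid_scheme) \<Rightarrow> ('v \<times> 'a) list set monoid" where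
  "free_product V G =
    \<lparr>carrier = syllable_words V G // free_product_rel V G,
     monoid.mult = (\<lambda>A B. \<Union>u\<in>A. \<Union>w\<in>B. free_product_rel V G `` {u @ w}),
     one = free_product_rel V G `` {[]}\<rparr>"

definition free_product_emb ::
    "'v set \<Rightarrow> ('v \<Rightarrow> ('a, 'b) monoid_scheme) \<Rightarrow> 'v \<Rightarrow> 'a \<Rightarrow> ('v \<times> 'a) list set" where
  "free_product_emb V G v g = free_product_rel V G `` {[(v, g)]}"

lemma syllable_words_simps [simp]:
  "[] \<in> syllable_words V G"
  "(v, g) # w \<in> syllable_words V G \<longleftrightarrow> v \<in> V \<and> g \<in> carrier (G v) \<and> w \<in> syllable_words V G"
  "u @ w \<in> syllable_words V G \<longleftrightarrow> u \<in> syllable_words V G \<and> w \<in> syllable_words V G"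
  by (auto simp: syllable_words_def)

lemma free_product_rel_words:
  assumes "\<And>v. v \<in> V \<Longrightarrow> group (G v)" "(u, w) \<in> free_product_rel V G"
  shows "u \<in> syllable_words V G \<and> w \<in> syllable_words V G"
  using assms(2)
proof induction
  case (one u w v)
  with assms(1)[of v] show ?case by (auto simp: group.is_monoid monoid.one_closed)
next
  case (mult u w v g h)
  with assms(1)[of v] show ?case by (auto simp: group.is_monoid monoid.m_closed)
qed auto

lemma equiv_free_product_rel:
  assumes "\<And>v. v \<in> V \<Longrightarrow> group (G v)"
  shows "equiv (syllable_words V G) (free_product_rel V G)"
proof (rule equivI)
  show "free_product_rel V G \<subseteq> syllable_words V G \<times> syllable_words V G"
    using free_product_rel_words[of V G] assms by auto
  show "refl_on (syllable_words V G) (free_product_rel V G)"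
    by (auto simp: refl_on_def intro: free_product_rel.refl)
  show "sym (free_product_rel V G)"
    by (auto intro: symI free_product_rel.sym)
  show "trans (free_product_rel V G)"
    by (auto intro: transI free_product_rel.trans)
qed

lemma free_product_rel_append_context:
  assumes "(u, w) \<in> free_product_rel V G" "p \<in> syllable_words V G" "q \<in> syllable_words V G"
  shows "(p @ u @ q, p @ w @ q) \<in> free_product_rel V G"
  using assms
proof induction
  case (refl w)
  then show ?case by (auto intro: free_product_rel.refl)
next
  case (sym u w)
  then show ?case by (auto intro: free_product_rel.sym)
next
  case (trans u v w)
  then show ?case by (auto intro: free_product_rel.trans)
next
  case (one u w v)
  then show ?case using free_product_rel.one[of "p @ u" V G "w @ q" v] by auto
next
  case (mult u w v g h)
  then show ?case using free_product_rel.mult[of "p @ u" V G "w @ q" v g h] by auto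
qed

lemma free_product_rel_append:
  assumes "\<And>v. v \<in> V \<Longrightarrow> group (G v)"
    and "(u, u') \<in> free_product_rel V G" "(w, w') \<in> free_product_rel V G"
  shows "(u @ w, u' @ w') \<in> free_product_rel V G"
proof -
  have "u' \<in> syllable_words V G" "w \<in> syllable_words V G"
    using free_product_rel_words[of V G] assms by blast+
  then show ?thesis
    using free_product_rel_append_context[OF assms(2), of "[]" w]
      free_product_rel_append_context[OF assms(3), of u' "[]"]
    by (auto intro: free_product_rel.trans)
qed

lemma free_product_mult_class:
  assumes "\<And>v. v \<in> V \<Longrightarrow> group (G v)"
    and "u \<in> syllable_words V G" "w \<in> syllable_words V G"
  shows "free_product_rel V G `` {u} \<otimes>\<^bsub>free_product V G\<^esub> free_product_rel V G `` {w} =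
    free_product_rel V G `` {u @ w}"
proof -
  let ?R = "free_product_rel V G"
  have R: "equiv (syllable_words V G) ?R"
    using assms(1) by (rule equiv_free_product_rel)
  have eq: "?R `` {u' @ w'} = ?R `` {u @ w}" if "u' \<in> ?R `` {u}" "w' \<in> ?R `` {w}" for u' w'
    using that equiv_class_eq[OF R free_product_rel_append[of V G u u' w w']] assms(1) by simp
  have "u \<in> ?R `` {u}" "w \<in> ?R `` {w}"
    using assms by (auto intro: free_product_rel.refl)
  then have "(\<Union>u'\<in>?R `` {u}. \<Union>w'\<in>?R `` {w}. ?R `` {u @ w}) = ?R `` {u @ w}"
    by blast
  then show ?thesis
    by (simp add: free_product_def eq cong: SUP_cong_simp)
qed

lemma group_free_product:
  assumes grp: "\<And>v. v \<in> V \<Longrightarrow> group (G v)"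
  shows "group (free_product V G)"
proof (rule groupI)
  let ?R = "free_product_rel V G" and ?W = "syllable_words V G" and ?F = "free_product V G"
  have car: "carrier ?F = ?W // ?R" and one: "\<one>\<^bsub>?F\<^esub> = ?R `` {[]}"
    by (simp_all add: free_product_def)
  note mult = free_product_mult_class[of V G, OF grp]
  show "\<one>\<^bsub>?F\<^esub> \<in> carrier ?F"
    by (simp add: car one quotientI)
  show "x \<otimes>\<^bsub>?F\<^esub> y \<in> carrier ?F" if "x \<in> carrier ?F" "y \<in> carrier ?F" for x y
    using that by (auto simp: car mult intro!: quotientI elim!: quotientE)
  show "x \<otimes>\<^bsub>?F\<^esub> y \<otimes>\<^bsub>?F\<^esub> z = x \<otimes>\<^bsub>?F\<^esub> (y \<otimes>\<^bsub>?F\<^esub> z)"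
    if "x \<in> carrier ?F" "y \<in> carrier ?F" "z \<in> carrier ?F" for x y z
    using that by (auto simp: car mult elim!: quotientE)
  show "\<one>\<^bsub>?F\<^esub> \<otimes>\<^bsub>?F\<^esub> x = x" if "x \<in> carrier ?F" for x
    using that by (auto simp: car one mult elim!: quotientE)
  have "\<exists>u\<in>?W. (u @ w, []) \<in> ?R" if "w \<in> ?W" for w
    using that
  proof (induction w)
    case Nil
    then show ?case by (auto intro!: bexI[of _ "[]"] free_product_rel.refl)
  next
    case (Cons s w)
    obtain v g where s: "s = (v, g)" by (cases s)
    with Cons.prems have v: "v \<in> V" "g \<in> carrier (G v)" and w: "w \<in> ?W" by auto
    then interpret group "G v" using grp by blast
    obtain u where u: "u \<in> ?W" "(u @ w, []) \<in> ?R" using Cons.IH w by blast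
    let ?u = "u @ [(v, inv\<^bsub>G v\<^esub> g)]"
    have "(?u @ s # w, u @ [(v, \<one>\<^bsub>G v\<^esub>)] @ w) \<in> ?R"
      using free_product_rel.mult[of u V G w v "inv\<^bsub>G v\<^esub> g" g] u v w by (simp add: s)
    moreover have "(u @ [(v, \<one>\<^bsub>G v\<^esub>)] @ w, u @ w) \<in> ?R"
      using u v w by (intro free_product_rel.one)
    ultimately have "(?u @ s # w, []) \<in> ?R"
      using u(2) by (blast intro: free_product_rel.trans)
    moreover have "?u \<in> ?W" using u v by simp
    ultimately show ?case by blast
  qed
  note left_inv = this
  show "\<exists>y\<in>carrier ?F. y \<otimes>\<^bsub>?F\<^esub> x = \<one>\<^bsub>?F\<^esub>" if "x \<in> carrier ?F" for x
  proof -
    from that obtain w where w: "w \<in> ?W" "x = ?R `` {w}" by (auto simp: car elim: quotientE)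
    with left_inv obtain u where u: "u \<in> ?W" "(u @ w, []) \<in> ?R" by blast
    have "?R `` {u @ w} = ?R `` {[]}"
      using equiv_free_product_rel[of V G, OF grp] u(2) by (rule equiv_class_eq)
    with w u have "?R `` {u} \<otimes>\<^bsub>?F\<^esub> x = \<one>\<^bsub>?F\<^esub>" by (simp add: mult one)
    moreover have "?R `` {u} \<in> carrier ?F" using u by (simp add: car quotientI)
    ultimately show ?thesis by blast
  qed
qed


section \<open>Graph products\<close>

definition normal_closure :: "('g, 'b) monoid_scheme \<Rightarrow> 'g set \<Rightarrow> 'g set" where
  "normal_closure G R = \<Inter>{N. N \<lhd> G \<and> R \<subseteq> N}"

text \<open>The relation \<open>gh = hg\<close> is encoded by the relator \<open>g h g\<inverse> h\<inverse>\<close>.\<close>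

definition commutation_relators ::
    "'v pair_pre_digraph \<Rightarrow> ('v \<Rightarrow> ('a, 'b) monoid_scheme) \<Rightarrow> ('v \<times> 'a) list set set" where
  "commutation_relators \<Gamma> G =
    (let F = free_product (pverts \<Gamma>) G; \<iota> = free_product_emb (pverts \<Gamma>) G in
      {\<iota> u g \<otimes>\<^bsub>F\<^esub> \<iota> v h \<otimes>\<^bsub>F\<^esub> inv\<^bsub>F\<^esub> (\<iota> u g) \<otimes>\<^bsub>F\<^esub> inv\<^bsub>F\<^esub> (\<iota> v h) |u v g h.
        (u, v) \<in> parcs \<Gamma> \<and> g \<in> carrier (G u) \<and> h \<in> carrier (G v)})"

definition graph_product ::
    "'v pair_pre_digraph \<Rightarrow> ('v \<Rightarrow> ('a, 'b) monoid_scheme) \<Rightarrow> ('v \<times> 'a) list set set monoid" where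
  "graph_product \<Gamma> G =
    (let F = free_product (pverts \<Gamma>) G in F Mod normal_closure F (commutation_relators \<Gamma> G))"

definition graph_product_emb ::
    "'v pair_pre_digraph \<Rightarrow> ('v \<Rightarrow> ('a, 'b) monoid_scheme) \<Rightarrow> 'v \<Rightarrow> 'a \<Rightarrow> ('v \<times> 'a) list set set"
  where
  "graph_product_emb \<Gamma> G v g =
    (let F = free_product (pverts \<Gamma>) G in
      normal_closure F (commutation_relators \<Gamma> G) #>\<^bsub>F\<^esub> free_product_emb (pverts \<Gamma>) G v g)"

definition vertex_subgroup ::
    "'v pair_pre_digraph \<Rightarrow> ('v \<Rightarrow> ('a, 'b) monoid_scheme) \<Rightarrow> 'v \<Rightarrow> ('v \<times> 'a) list set set set" where
  "vertex_subgroup \<Gamma> G v = graph_product_emb \<Gamma> G v ` carrier (G v)"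

lemma (in group) normal_normal_closure:
  assumes "R \<subseteq> carrier G"
  shows "normal_closure G R \<lhd> G"
proof -
  let ?S = "{N. N \<lhd> G \<and> R \<subseteq> N}"
  have "carrier G \<in> ?S"
    using assms by (auto simp: normal_inv_iff subgroup_self)
  then have "subgroup (\<Inter>?S) G"
    by (intro subgroups_Inter) (auto simp: normal_imp_subgroup)
  then show ?thesis
    unfolding normal_closure_def by (auto simp: normal_inv_iff)
qed

lemma group_graph_product:
  assumes "pair_wf_digraph \<Gamma>" and grp: "\<And>v. v \<in> pverts \<Gamma> \<Longrightarrow> group (G v)"
  shows "group (graph_product \<Gamma> G)"
proof -
  interpret F: group "free_product (pverts \<Gamma>) G"
    using grp by (rule group_free_product)
  have emb: "free_product_emb (pverts \<Gamma>) G v g \<in> carrier (free_product (pverts \<Gamma>) G)"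
    if "v \<in> pverts \<Gamma>" "g \<in> carrier (G v)" for v g
    using that by (auto simp: free_product_def free_product_emb_def intro!: quotientI)
  have "commutation_relators \<Gamma> G \<subseteq> carrier (free_product (pverts \<Gamma>) G)"
    unfolding commutation_relators_def Let_def
    using pair_wf_digraph.wellformed'[OF assms(1)] by (auto intro!: F.m_closed F.inv_closed emb)
  then show ?thesis
    by (simp add: graph_product_def Let_def normal.factorgroup_is_group F.normal_normal_closure)
qed


section \<open>Words and languages\<close>

datatype ('v, 'y) letter = Gen 'v 'y | Inv_Gen 'v 'y

fun inv_letter :: "('v, 'y) letter \<Rightarrow> ('v, 'y) letter" where
  "inv_letter (Gen v y) = Inv_Gen v y"
| "inv_letter (Inv_Gen v y) = Gen v y"

definition alphabet :: "'v set \<Rightarrow> ('v \<Rightarrow> 'y set) \<Rightarrow> ('v, 'y) letter set" where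
  "alphabet V Y = (\<Union>v\<in>V. Gen v ` Y v \<union> Inv_Gen v ` Y v)"

definition free_monoid :: "'x set \<Rightarrow> 'x list monoid" where
  "free_monoid X = \<lparr>carrier = lists X, monoid.mult = (@), one = []\<rparr>"

definition geodesics :: "'x set \<Rightarrow> ('x list \<Rightarrow> 'g) \<Rightarrow> 'x list set" where
  "geodesics X \<phi> = {w \<in> lists X. \<not> (\<exists>u\<in>lists X. \<phi> u = \<phi> w \<and> length u < length w)}"

definition positive_cone_language ::
    "'x set \<Rightarrow> ('x list \<Rightarrow> 'g) \<Rightarrow> ('g, 'b) monoid_scheme \<Rightarrow> 'g rel \<Rightarrow> 'x list set" where
  "positive_cone_language X \<phi> G r = {w \<in> geodesics X \<phi>. positive_element G r (\<phi> w)}"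

text \<open>Acceptance by a deterministic finite state automaton; as state sets are finite, natural
  numbers suffice as states.\<close>

definition regular_language :: "'x set \<Rightarrow> 'x list set \<Rightarrow> bool" where
  "regular_language X L \<longleftrightarrow>
    (\<exists>(Q :: nat set) q\<^sub>0 \<delta> F. finite Q \<and> q\<^sub>0 \<in> Q \<and> (\<forall>q\<in>Q. \<forall>x\<in>X. \<delta> q x \<in> Q) \<and> F \<subseteq> Q \<and>
       L = {w \<in> lists X. foldl \<delta> q\<^sub>0 w \<in> F})"

end

theory Submission
  imports Defs "HOL-Algebra.Bij"
begin

text \<open>
  The argument is a Myhill--Nerode argument. Suppose that \<open>S\<close> and \<open>T\<close> are disjoint sets of group
  elements, both cofinal in the order, such that a geodesic for \<open>s\<inverse>\<close> followed by a geodesic for \<open>t\<close>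
  is again a geodesic whenever \<open>s \<in> S\<close> and \<open>t \<in> T\<close>. This concatenation lies in the positive cone
  language exactly if \<open>s < t\<close>. Hence the state that an automaton reaches on the geodesic for \<open>s\<inverse>\<close>
  determines which elements of \<open>T\<close> lie above \<open>s\<close>. As \<open>S\<close> and \<open>T\<close> alternate infinitely often on the
  way up, infinitely many states would be needed (\<open>positive_cone_not_regular\<close>).

  Diameter at least 3 provides distinct vertices \<open>a\<close> and \<open>b\<close> that are neither adjacent nor joined to
  a common neighbour. Call a vertex \<open>v\<close> a head of \<open>x\<close> if some reduced expression of \<open>x\<close> starts with
  a syllable from \<open>G\<^sub>v\<close>; distinct heads are adjacent. The sets \<open>S\<close> and \<open>T\<close> consist of the elements whose
  only head is \<open>a\<close>, respectively \<open>b\<close>. Both properties asked for above are facts about heads.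

  \<^item> Cofinality (\<open>steer_heads\<close>, \<open>finite_translates_cofinal\<close>): fix nontrivial \<open>g \<in> G\<^sub>a\<close> and \<open>h \<in> G\<^sub>b\<close>.
    For every \<open>x\<close>, one of \<open>g x\<close> and \<open>g h x\<close> has \<open>a\<close> as its only head: any other head would commute
    with \<open>a\<close> and would also be equal or adjacent to \<open>b\<close>. If no element of \<open>S\<close> were above \<open>y\<close>, this
    would fail for any \<open>x\<close> above both \<open>g\<inverse> y\<close> and \<open>(g h)\<inverse> y\<close>.

  \<^item> Geodesics (\<open>norm_inv_mult\<close>, \<open>geodesic_append\<close>): if \<open>s\<close> and \<open>t\<close> have no common head, then nothing
    cancels or merges in \<open>s\<inverse> t\<close>, so that word lengths add up.

  Both rest on the uniqueness of reduced expressions up to shuffling of commuting syllables (Green's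
  normal form theorem). It is obtained here by letting the graph product act on pilings, in which
  adjacent vertices occupy disjoint sets of stacks; the reduced expressions of one element all have
  the same piling (\<open>reduced_unique\<close>).
\<close>

section \<open>The universal property of graph products\<close>

locale graph_of_groups =
  fixes \<Gamma> :: "'v pair_pre_digraph" and G :: "'v \<Rightarrow> ('a, 'b) monoid_scheme"
  assumes pair_graph: "pair_graph \<Gamma>"
    and vertex_group: "v \<in> pverts \<Gamma> \<Longrightarrow> group (G v)"
begin

abbreviation "V \<equiv> pverts \<Gamma>"
abbreviation "E \<equiv> parcs \<Gamma>"
abbreviation "F \<equiv> free_product V G"
abbreviation "R \<equiv> free_product_rel V G"
abbreviation "N \<equiv> normal_closure F (commutation_relators \<Gamma> G)"
abbreviation "H \<equiv> graph_product \<Gamma> G"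
abbreviation "\<kappa> \<equiv> free_product_emb V G"
abbreviation "\<iota> \<equiv> graph_product_emb \<Gamma> G"

lemma edge_sym: "(u, v) \<in> E \<Longrightarrow> (v, u) \<in> E"
proof -
  interpret pair_graph \<Gamma> by (rule pair_graph)
  show "(u, v) \<in> E \<Longrightarrow> (v, u) \<in> E"
    using pair_sym_arcs by (auto simp: symmetric_def sym_def)
qed

lemma no_loop [simp]: "(v, v) \<notin> E"
proof -
  interpret pair_graph \<Gamma> by (rule pair_graph)
  show ?thesis using pair_no_loops[of "(v, v)"] by auto
qed

lemma finite_vertices: "finite V"
proof -
  interpret pair_graph \<Gamma> by (rule pair_graph)
  show ?thesis by (rule pair_finite_verts)
qed

lemma pair_wf: "pair_wf_digraph \<Gamma>"
proof -
  interpret pair_graph \<Gamma> by (rule pair_graph)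
  show ?thesis by unfold_locales
qed

lemma edge_vertices: "(u, v) \<in> E \<Longrightarrow> u \<in> V \<and> v \<in> V"
  using pair_wf_digraph.wellformed'[OF pair_wf] by blast

lemma one_closed: "v \<in> V \<Longrightarrow> \<one>\<^bsub>G v\<^esub> \<in> carrier (G v)"
  by (simp add: vertex_group group.is_monoid monoid.one_closed)

sublocale F: group F
  using vertex_group by (rule group_free_product)

sublocale H: group H
  using pair_wf vertex_group by (rule group_graph_product)

lemma equiv_rel: "equiv (syllable_words V G) R"
  using vertex_group by (rule equiv_free_product_rel)

lemma word_mult:
  "\<lbrakk>u \<in> syllable_words V G; w \<in> syllable_words V G\<rbrakk> \<Longrightarrow> R `` {u} \<otimes>\<^bsub>F\<^esub> R `` {w} = R `` {u @ w}"
  by (rule free_product_mult_class) (rule vertex_group)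

lemma kappa_closed: "\<lbrakk>v \<in> V; g \<in> carrier (G v)\<rbrakk> \<Longrightarrow> \<kappa> v g \<in> carrier F"
  by (auto simp: free_product_def free_product_emb_def intro!: quotientI)

lemma kappa_mult:
  assumes "v \<in> V" "g \<in> carrier (G v)" "h \<in> carrier (G v)"
  shows "\<kappa> v (g \<otimes>\<^bsub>G v\<^esub> h) = \<kappa> v g \<otimes>\<^bsub>F\<^esub> \<kappa> v h"
proof -
  have "([] @ [(v, g), (v, h)] @ [], [] @ [(v, g \<otimes>\<^bsub>G v\<^esub> h)] @ []) \<in> R"
    using assms by (intro free_product_rel.mult) auto
  then have "R `` {[(v, g), (v, h)]} = R `` {[(v, g \<otimes>\<^bsub>G v\<^esub> h)]}"
    using equiv_class_eq[OF equiv_rel] by simp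
  then show ?thesis
    using assms by (simp add: free_product_emb_def word_mult)
qed

lemma relators_closed: "commutation_relators \<Gamma> G \<subseteq> carrier F"
proof
  fix x assume "x \<in> commutation_relators \<Gamma> G"
  then obtain u v g h where "(u, v) \<in> E" "g \<in> carrier (G u)" "h \<in> carrier (G v)"
    and x: "x = \<kappa> u g \<otimes>\<^bsub>F\<^esub> \<kappa> v h \<otimes>\<^bsub>F\<^esub> inv\<^bsub>F\<^esub> \<kappa> u g \<otimes>\<^bsub>F\<^esub> inv\<^bsub>F\<^esub> \<kappa> v h"
    unfolding commutation_relators_def Let_def by blast
  then show "x \<in> carrier F"
    using edge_vertices[of u v] by (simp add: kappa_closed)
qed

sublocale N: normal N F
  using relators_closed by (rule F.normal_normal_closure)

lemma graph_product_eq: "H = F Mod N"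
  by (simp add: graph_product_def Let_def)

lemma iota_eq: "\<iota> v g = N #>\<^bsub>F\<^esub> \<kappa> v g"
  by (simp add: graph_product_emb_def Let_def)

lemma iota_closed [simp]: "\<lbrakk>v \<in> V; g \<in> carrier (G v)\<rbrakk> \<Longrightarrow> \<iota> v g \<in> carrier H"
  by (auto simp: graph_product_eq iota_eq carrier_FactGroup kappa_closed)

lemma iota_mult:
  "\<lbrakk>v \<in> V; g \<in> carrier (G v); h \<in> carrier (G v)\<rbrakk>
    \<Longrightarrow> \<iota> v (g \<otimes>\<^bsub>G v\<^esub> h) = \<iota> v g \<otimes>\<^bsub>H\<^esub> \<iota> v h"
  by (simp add: graph_product_eq iota_eq kappa_mult N.rcos_sum kappa_closed)

lemma iota_hom: "v \<in> V \<Longrightarrow> \<iota> v \<in> hom (G v) H"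
  by (auto simp: hom_def iota_mult)

lemma iota_group_hom: "v \<in> V \<Longrightarrow> group_hom (G v) H (\<iota> v)"
  by (simp add: group_hom_def group_hom_axioms_def vertex_group iota_hom H.group_axioms)

lemma iota_one [simp]: "v \<in> V \<Longrightarrow> \<iota> v \<one>\<^bsub>G v\<^esub> = \<one>\<^bsub>H\<^esub>"
  using group_hom.hom_one[OF iota_group_hom] .

lemma iota_inv:
  "\<lbrakk>v \<in> V; g \<in> carrier (G v)\<rbrakk> \<Longrightarrow> \<iota> v (inv\<^bsub>G v\<^esub> g) = inv\<^bsub>H\<^esub> \<iota> v g"
  using group_hom.hom_inv[OF iota_group_hom] .

lemma iota_commute:
  assumes "(u, v) \<in> E" "g \<in> carrier (G u)" "h \<in> carrier (G v)"
  shows "\<iota> u g \<otimes>\<^bsub>H\<^esub> \<iota> v h = \<iota> v h \<otimes>\<^bsub>H\<^esub> \<iota> u g"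
proof -
  have V: "u \<in> V" "v \<in> V" using assms edge_vertices by auto
  let ?a = "\<kappa> u g" and ?b = "\<kappa> v h"
  have a: "?a \<in> carrier F" and b: "?b \<in> carrier F" using V assms by (auto intro: kappa_closed)
  have "commutation_relators \<Gamma> G \<subseteq> N" unfolding normal_closure_def by blast
  then have c: "?a \<otimes>\<^bsub>F\<^esub> ?b \<otimes>\<^bsub>F\<^esub> inv\<^bsub>F\<^esub> ?a \<otimes>\<^bsub>F\<^esub> inv\<^bsub>F\<^esub> ?b \<in> N"
    using assms unfolding commutation_relators_def Let_def by blast
  have "?a \<otimes>\<^bsub>F\<^esub> ?b = (?a \<otimes>\<^bsub>F\<^esub> ?b \<otimes>\<^bsub>F\<^esub> inv\<^bsub>F\<^esub> ?a \<otimes>\<^bsub>F\<^esub> inv\<^bsub>F\<^esub> ?b) \<otimes>\<^bsub>F\<^esub> (?b \<otimes>\<^bsub>F\<^esub> ?a)"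
  proof -
    have "inv\<^bsub>F\<^esub> ?b \<otimes>\<^bsub>F\<^esub> (?b \<otimes>\<^bsub>F\<^esub> ?a) = ?a"
      using a b by (simp flip: F.m_assoc)
    then show ?thesis using a b by (simp add: F.m_assoc)
  qed
  then have "?a \<otimes>\<^bsub>F\<^esub> ?b \<in> N #>\<^bsub>F\<^esub> (?b \<otimes>\<^bsub>F\<^esub> ?a)"
    using c unfolding r_coset_def by blast
  then have "N #>\<^bsub>F\<^esub> (?a \<otimes>\<^bsub>F\<^esub> ?b) = N #>\<^bsub>F\<^esub> (?b \<otimes>\<^bsub>F\<^esub> ?a)"
    using F.repr_independence[of _ N "?b \<otimes>\<^bsub>F\<^esub> ?a"] a b N.subgroup_axioms by auto
  then show ?thesis
    using a b by (simp add: graph_product_eq iota_eq N.rcos_sum)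
qed

lemma graph_product_induct [consumes 1, case_names one mult]:
  assumes "x \<in> carrier H"
    and "P \<one>\<^bsub>H\<^esub>"
    and "\<And>v g x. \<lbrakk>v \<in> V; g \<in> carrier (G v); x \<in> carrier H; P x\<rbrakk> \<Longrightarrow> P (\<iota> v g \<otimes>\<^bsub>H\<^esub> x)"
  shows "P x"
proof -
  have one: "R `` {[]} = \<one>\<^bsub>F\<^esub>" by (simp add: free_product_def)
  have "R `` {w} \<in> carrier F \<and> P (N #>\<^bsub>F\<^esub> (R `` {w}))" if "w \<in> syllable_words V G" for w
    using that
  proof (induction w)
    case Nil
    have "N #>\<^bsub>F\<^esub> \<one>\<^bsub>F\<^esub> = \<one>\<^bsub>H\<^esub>"
      using F.coset_mult_one[OF N.subset] by (simp add: graph_product_eq)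
    then show ?case using assms(2) by (simp add: one)
  next
    case (Cons s w)
    obtain v g where s: "s = (v, g)" by (cases s)
    have *: "v \<in> V" "g \<in> carrier (G v)" "w \<in> syllable_words V G" using Cons.prems s by auto
    have IH: "R `` {w} \<in> carrier F" "P (N #>\<^bsub>F\<^esub> (R `` {w}))" using Cons.IH * by auto
    have eq: "R `` {s # w} = \<kappa> v g \<otimes>\<^bsub>F\<^esub> R `` {w}"
      using * by (simp add: free_product_emb_def word_mult s)
    have "N #>\<^bsub>F\<^esub> (R `` {s # w}) = \<iota> v g \<otimes>\<^bsub>H\<^esub> (N #>\<^bsub>F\<^esub> (R `` {w}))"
      using IH * by (simp add: eq graph_product_eq iota_eq N.rcos_sum kappa_closed)
    moreover have "N #>\<^bsub>F\<^esub> (R `` {w}) \<in> carrier H"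
      using IH by (auto simp: graph_product_eq carrier_FactGroup)
    ultimately show ?case
      using assms(3) IH * by (auto simp: eq intro!: F.m_closed kappa_closed)
  qed
  moreover obtain w where "w \<in> syllable_words V G" "x = N #>\<^bsub>F\<^esub> (R `` {w})"
    using assms(1) by (auto simp: graph_product_eq carrier_FactGroup free_product_def elim!: quotientE)
  ultimately show ?thesis by blast
qed

lemma free_product_universal:
  assumes "group K" and f: "\<And>v. v \<in> V \<Longrightarrow> f v \<in> hom (G v) K"
  obtains h where "h \<in> hom F K" "\<And>v g. \<lbrakk>v \<in> V; g \<in> carrier (G v)\<rbrakk> \<Longrightarrow> h (\<kappa> v g) = f v g"
proof -
  interpret K: group K by (rule assms(1))
  define ev where "ev = (\<lambda>w. foldr (\<lambda>(v, g) x. f v g \<otimes>\<^bsub>K\<^esub> x) w \<one>\<^bsub>K\<^esub>)"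
  have ev_simps [simp]: "ev [] = \<one>\<^bsub>K\<^esub>" "ev ((v, g) # w) = f v g \<otimes>\<^bsub>K\<^esub> ev w" for v g w
    by (simp_all add: ev_def)
  have fc: "f v g \<in> carrier K" if "v \<in> V" "g \<in> carrier (G v)" for v g
    using f that by (auto simp: hom_def)
  have closed: "ev w \<in> carrier K" if "w \<in> syllable_words V G" for w
    using that by (induction w) (auto simp: fc)
  have app: "ev (u @ w) = ev u \<otimes>\<^bsub>K\<^esub> ev w" if "u \<in> syllable_words V G" "w \<in> syllable_words V G" for u w
    using that by (induction u) (auto simp: fc closed K.m_assoc)
  have resp: "ev u = ev w" if "(u, w) \<in> R" for u w
    using that
  proof induction
    case (one u w v)
    have "f v \<one>\<^bsub>G v\<^esub> = \<one>\<^bsub>K\<^esub>"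
      using hom_one[OF f vertex_group K.group_axioms] one by simp
    then show ?case using one by (simp add: app closed one_closed)
  next
    case (mult u w v g h)
    have "f v (g \<otimes>\<^bsub>G v\<^esub> h) = f v g \<otimes>\<^bsub>K\<^esub> f v h"
      using hom_mult[OF f] mult by simp
    moreover have "g \<otimes>\<^bsub>G v\<^esub> h \<in> carrier (G v)"
      using mult vertex_group by (simp add: group.is_monoid monoid.m_closed)
    ultimately show ?case using mult by (simp add: app closed fc K.m_assoc)
  qed auto
  define h where "h = (\<lambda>A. ev (SOME w. w \<in> A))"
  have h: "h (R `` {w}) = ev w" if "w \<in> syllable_words V G" for w
  proof -
    have "w \<in> R `` {w}" using that by (auto intro: free_product_rel.refl)
    then have "(SOME w'. w' \<in> R `` {w}) \<in> R `` {w}" by (rule someI)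
    then show ?thesis unfolding h_def using resp by force
  qed
  have "h \<in> hom F K"
  proof (rule homI)
    show "h x \<in> carrier K" if "x \<in> carrier F" for x
      using that by (auto simp: free_product_def h closed elim!: quotientE)
    show "h (x \<otimes>\<^bsub>F\<^esub> y) = h x \<otimes>\<^bsub>K\<^esub> h y" if "x \<in> carrier F" "y \<in> carrier F" for x y
    proof -
      obtain u w where "u \<in> syllable_words V G" "x = R `` {u}" "w \<in> syllable_words V G" "y = R `` {w}"
        using \<open>x \<in> carrier F\<close> \<open>y \<in> carrier F\<close> by (auto simp: free_product_def elim!: quotientE)
      then show ?thesis by (simp add: word_mult h app)
    qed
  qed
  moreover have "h (\<kappa> v g) = f v g" if "v \<in> V" "g \<in> carrier (G v)" for v g
    using that by (simp add: free_product_emb_def h fc)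
  ultimately show ?thesis using that by blast
qed

text \<open>This is the only access to the kernel of the quotient map: distinct elements of the graph product
  will be told apart by a homomorphism that this lemma provides.\<close>

lemma graph_product_universal:
  assumes "group K" and f: "\<And>v. v \<in> V \<Longrightarrow> f v \<in> hom (G v) K"
    and comm: "\<And>u v g h. \<lbrakk>(u, v) \<in> E; g \<in> carrier (G u); h \<in> carrier (G v)\<rbrakk>
      \<Longrightarrow> f u g \<otimes>\<^bsub>K\<^esub> f v h = f v h \<otimes>\<^bsub>K\<^esub> f u g"
  obtains h where "h \<in> hom H K" "\<And>v g. \<lbrakk>v \<in> V; g \<in> carrier (G v)\<rbrakk> \<Longrightarrow> h (\<iota> v g) = f v g"
proof -
  interpret K: group K by (rule assms(1))
  obtain h where h: "h \<in> hom F K" "\<And>v g. \<lbrakk>v \<in> V; g \<in> carrier (G v)\<rbrakk> \<Longrightarrow> h (\<kappa> v g) = f v g"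
    using free_product_universal[OF assms(1) f] by blast
  interpret h: group_hom F K h by unfold_locales (rule h)
  have "h (\<kappa> u g \<otimes>\<^bsub>F\<^esub> \<kappa> v k \<otimes>\<^bsub>F\<^esub> inv\<^bsub>F\<^esub> \<kappa> u g \<otimes>\<^bsub>F\<^esub> inv\<^bsub>F\<^esub> \<kappa> v k) = \<one>\<^bsub>K\<^esub>"
    if e: "(u, v) \<in> E" "g \<in> carrier (G u)" "k \<in> carrier (G v)" for u v g k
  proof -
    have V: "u \<in> V" "v \<in> V" using e edge_vertices by auto
    have c: "f u g \<in> carrier K" "f v k \<in> carrier K" using f V e by (auto simp: hom_def)
    have "h (\<kappa> u g \<otimes>\<^bsub>F\<^esub> \<kappa> v k \<otimes>\<^bsub>F\<^esub> inv\<^bsub>F\<^esub> \<kappa> u g \<otimes>\<^bsub>F\<^esub> inv\<^bsub>F\<^esub> \<kappa> v k)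
      = f u g \<otimes>\<^bsub>K\<^esub> f v k \<otimes>\<^bsub>K\<^esub> inv\<^bsub>K\<^esub> f u g \<otimes>\<^bsub>K\<^esub> inv\<^bsub>K\<^esub> f v k"
      using V e by (simp add: kappa_closed h(2))
    also have "\<dots> = \<one>\<^bsub>K\<^esub>"
    proof -
      have "f u g \<otimes>\<^bsub>K\<^esub> (inv\<^bsub>K\<^esub> f u g \<otimes>\<^bsub>K\<^esub> inv\<^bsub>K\<^esub> f v k) = inv\<^bsub>K\<^esub> f v k"
        using c by (simp flip: K.m_assoc)
      then show ?thesis using c by (simp add: comm[OF e] K.m_assoc)
    qed
    finally show ?thesis .
  qed
  then have "commutation_relators \<Gamma> G \<subseteq> kernel F K h"
    using relators_closed unfolding kernel_def commutation_relators_def Let_def by blast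
  then have "N \<subseteq> kernel F K h"
    unfolding normal_closure_def using h.normal_kernel by blast
  then obtain k where k: "k \<in> hom (F Mod N) K" "\<And>x. x \<in> carrier F \<Longrightarrow> k (N #>\<^bsub>F\<^esub> x) = h x"
    using h.FactGroup_universal_kernel[OF N.normal_axioms] by blast
  show ?thesis
    by (rule that[of k]) (use k h in \<open>auto simp: graph_product_eq iota_eq kappa_closed\<close>)
qed

end

section \<open>Pilings and reduced expressions\<close>

type_synonym ('v, 'a) piling = "'v \<Rightarrow> 'v \<Rightarrow> ('v \<times> 'a) list"

context graph_of_groups
begin

text \<open>
  A piling keeps one stack of syllables for every pair of vertices that do not commute, including the
  pairs \<open>(v, v)\<close>, with the top of each stack at the head of the list. A word is recorded in the stack
  \<open>(c, d)\<close> by its subword of syllables at \<open>c\<close> or \<open>d\<close>. Since \<open>(u, v)\<close> has no stack if \<open>u\<close> and \<open>v\<close> are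
  adjacent, operations at adjacent vertices touch disjoint sets of stacks and commute literally, not
  just up to shuffling.
\<close>

definition push :: "'v \<Rightarrow> 'a \<Rightarrow> ('v, 'a) piling \<Rightarrow> ('v, 'a) piling" where
  "push v g p = (\<lambda>c d. if (c = v \<or> d = v) \<and> (c, d) \<notin> E then (v, g) # p c d else p c d)"

definition pop :: "'v \<Rightarrow> ('v, 'a) piling \<Rightarrow> ('v, 'a) piling" where
  "pop v p = (\<lambda>c d. if (c = v \<or> d = v) \<and> (c, d) \<notin> E then tl (p c d) else p c d)"

text \<open>The stacks \<open>(v, d)\<close> say which syllables block \<open>v\<close>: the first syllable at \<open>v\<close> can be shuffled to
  the front of the word exactly if no syllable at a vertex not commuting with \<open>v\<close> precedes it. The
  case \<open>d = v\<close> demands that there is a syllable at \<open>v\<close> at all.\<close>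

definition on_top :: "'v \<Rightarrow> ('v, 'a) piling \<Rightarrow> bool" where
  "on_top v p \<longleftrightarrow> (\<forall>d. (v, d) \<notin> E \<longrightarrow> p v d \<noteq> [] \<and> fst (hd (p v d)) = v)"

definition put :: "'v \<Rightarrow> 'a \<Rightarrow> ('v, 'a) piling \<Rightarrow> ('v, 'a) piling" where
  "put v g p = (if g = \<one>\<^bsub>G v\<^esub> then p else push v g p)"

definition top_syllable :: "'v \<Rightarrow> ('v, 'a) piling \<Rightarrow> 'a" where
  "top_syllable v p = (if on_top v p then snd (hd (p v v)) else \<one>\<^bsub>G v\<^esub>)"

definition rest :: "'v \<Rightarrow> ('v, 'a) piling \<Rightarrow> ('v, 'a) piling" where
  "rest v p = (if on_top v p then pop v p else p)"

text \<open>Among the pilings of reduced words, those with \<open>v\<close> not on top form a transversal for the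
  orbits of \<open>G\<^sub>v\<close>: a piling corresponds to the pair of its top syllable at \<open>v\<close> (the identity if \<open>v\<close>
  is not on top) and
  the rest, and \<open>G\<^sub>v\<close> acts by left multiplication on the first component.\<close>

definition act :: "'v \<Rightarrow> 'a \<Rightarrow> ('v, 'a) piling \<Rightarrow> ('v, 'a) piling" where
  "act v g p = put v (g \<otimes>\<^bsub>G v\<^esub> top_syllable v p) (rest v p)"

lemma on_top_push_self [simp]: "on_top v (push v g p)"
  by (simp add: on_top_def push_def)

lemma top_syllable_push_self [simp]: "top_syllable v (push v g p) = g"
  using on_top_push_self[of v g p] unfolding top_syllable_def by (simp add: push_def)

lemma rest_push_self [simp]: "rest v (push v g p) = p"
  using on_top_push_self[of v g p] unfolding rest_def by (simp add: pop_def push_def fun_eq_iff)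

lemma not_on_top_push: "\<lbrakk>u \<noteq> v; (u, v) \<notin> E\<rbrakk> \<Longrightarrow> \<not> on_top v (push u g p)"
  using edge_sym[of v u] by (auto simp: on_top_def push_def intro!: exI[of _ u])

lemma on_top_push_adj: "(u, v) \<in> E \<Longrightarrow> on_top v (push u g p) = on_top v p"
  using edge_sym[of u v] by (auto simp: on_top_def push_def)

lemma on_top_pop_adj: "(u, v) \<in> E \<Longrightarrow> on_top v (pop u p) = on_top v p"
  using edge_sym[of u v] by (auto simp: on_top_def pop_def)

lemma on_top_rest_adj: "(u, v) \<in> E \<Longrightarrow> on_top v (rest u p) = on_top v p"
  by (simp add: rest_def on_top_pop_adj)

lemma top_syllable_push_adj: "(u, v) \<in> E \<Longrightarrow> top_syllable v (push u g p) = top_syllable v p"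
  by (auto simp: top_syllable_def on_top_push_adj) (auto simp: push_def)

lemma top_syllable_put_adj: "(u, v) \<in> E \<Longrightarrow> top_syllable v (put u g p) = top_syllable v p"
  by (simp add: put_def top_syllable_push_adj)

lemma top_syllable_rest_adj: "(u, v) \<in> E \<Longrightarrow> top_syllable v (rest u p) = top_syllable v p"
  unfolding top_syllable_def by (auto simp: on_top_rest_adj) (auto simp: rest_def pop_def)

lemma rest_push_adj: "(u, v) \<in> E \<Longrightarrow> rest v (push u g p) = push u g (rest v p)"
  using edge_sym[of u v]
  by (auto simp: rest_def on_top_push_adj) (auto simp: push_def pop_def fun_eq_iff)

lemma rest_put_adj: "(u, v) \<in> E \<Longrightarrow> rest v (put u g p) = put u g (rest v p)"
  by (simp add: put_def rest_push_adj)

lemma rest_rest_adj: "(u, v) \<in> E \<Longrightarrow> rest v (rest u p) = rest u (rest v p)"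
  using edge_sym[of u v] unfolding rest_def
  by (auto simp: on_top_pop_adj) (auto simp: pop_def fun_eq_iff)

lemma push_push_adj: "(u, v) \<in> E \<Longrightarrow> push v h (push u g p) = push u g (push v h p)"
  using edge_sym[of u v] by (auto simp: push_def fun_eq_iff)

lemma put_put_adj: "(u, v) \<in> E \<Longrightarrow> put v h (put u g p) = put u g (put v h p)"
  by (simp add: put_def push_push_adj)

lemma act_commute:
  assumes "(u, v) \<in> E"
  shows "act u g (act v h p) = act v h (act u g p)"
  using assms edge_sym[OF assms] unfolding act_def
  by (simp add: top_syllable_put_adj top_syllable_rest_adj rest_put_adj put_put_adj[OF assms]
      rest_rest_adj[OF assms])

lemma top_syllable_put: "\<not> on_top v p \<Longrightarrow> top_syllable v (put v g p) = g"
  by (simp add: put_def) (simp add: top_syllable_def)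

lemma rest_put: "\<not> on_top v p \<Longrightarrow> rest v (put v g p) = p"
  by (simp add: put_def) (simp add: rest_def)

text \<open>The group element is carried along with the piling of a reduced word for it, so that one
  induction handles the combinatorics of the piling and the corresponding rewriting in the group.\<close>

inductive reduced :: "('v, 'a) piling \<Rightarrow> ('v \<times> 'a) list set set \<Rightarrow> bool" where
  empty: "reduced (\<lambda>_ _. []) \<one>\<^bsub>H\<^esub>"
| push: "\<lbrakk>reduced p x; v \<in> V; g \<in> carrier (G v); g \<noteq> \<one>\<^bsub>G v\<^esub>; \<not> on_top v p\<rbrakk>
    \<Longrightarrow> reduced (push v g p) (\<iota> v g \<otimes>\<^bsub>H\<^esub> x)"

lemma reduced_closed: "reduced p x \<Longrightarrow> x \<in> carrier H"
  by (induction rule: reduced.induct) auto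

lemma reduced_put:
  "\<lbrakk>reduced p x; v \<in> V; g \<in> carrier (G v); \<not> on_top v p\<rbrakk> \<Longrightarrow> reduced (put v g p) (\<iota> v g \<otimes>\<^bsub>H\<^esub> x)"
  using reduced.push[of p x v g] reduced_closed[of p x] by (auto simp: put_def)

text \<open>A syllable on top of the piling can be shuffled to the front of the reduced word, and the word
  stays reduced when it is removed. In the induction over the word, a first syllable at
  another vertex not adjacent to \<open>v\<close> prevents \<open>v\<close> from being on top; one at a neighbour of \<open>v\<close> is exchanged
  with the syllable that the induction hypothesis brings to the front.\<close>

lemma reduced_split:
  assumes "reduced p x" "v \<in> V"
  obtains y where "reduced (rest v p) y" "\<not> on_top v (rest v p)"
    "top_syllable v p \<in> carrier (G v)" "put v (top_syllable v p) (rest v p) = p"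
    "x = \<iota> v (top_syllable v p) \<otimes>\<^bsub>H\<^esub> y"
proof -
  have triv: "\<exists>y. reduced (rest v p) y \<and> \<not> on_top v (rest v p) \<and>
    top_syllable v p \<in> carrier (G v) \<and> put v (top_syllable v p) (rest v p) = p \<and>
    x = \<iota> v (top_syllable v p) \<otimes>\<^bsub>H\<^esub> y" if "reduced p x" "\<not> on_top v p" for p x
    using that assms(2) reduced_closed[OF that(1)]
    by (auto simp: rest_def top_syllable_def put_def one_closed intro!: exI[of _ x])
  have "\<exists>y. reduced (rest v p) y \<and> \<not> on_top v (rest v p) \<and>
    top_syllable v p \<in> carrier (G v) \<and> put v (top_syllable v p) (rest v p) = p \<and>
    x = \<iota> v (top_syllable v p) \<otimes>\<^bsub>H\<^esub> y"
    using assms(1)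
  proof (induction rule: reduced.induct)
    case empty
    have "\<not> on_top v (\<lambda>_ _. [])" using no_loop[of v] unfolding on_top_def by blast
    then show ?case using triv reduced.empty by blast
  next
    case (push p x u g)
    consider "u = v" | "u \<noteq> v" "(u, v) \<notin> E" | "(u, v) \<in> E" by blast
    then show ?case
    proof cases
      case 1
      then show ?thesis using push by (auto simp: put_def)
    next
      case 2
      then show ?thesis using triv[OF reduced.push] push.hyps not_on_top_push by blast
    next
      case 3
      obtain y where y: "reduced (rest v p) y" "\<not> on_top v (rest v p)"
        "top_syllable v p \<in> carrier (G v)" "put v (top_syllable v p) (rest v p) = p"
        "x = \<iota> v (top_syllable v p) \<otimes>\<^bsub>H\<^esub> y" using push.IH by blast
      have "reduced (push u g (rest v p)) (\<iota> u g \<otimes>\<^bsub>H\<^esub> y)"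
        using y push.hyps 3 edge_sym by (intro reduced.push) (auto simp: on_top_rest_adj)
      moreover have "put v (top_syllable v p) (push u g (rest v p)) = push u g p"
        using put_put_adj[OF 3, of "top_syllable v p" g "rest v p"] push.hyps y(4) by (simp add: put_def[of u])
      moreover have "\<iota> u g \<otimes>\<^bsub>H\<^esub> x = \<iota> v (top_syllable v p) \<otimes>\<^bsub>H\<^esub> (\<iota> u g \<otimes>\<^bsub>H\<^esub> y)"
        using iota_commute[OF 3 \<open>g \<in> carrier (G u)\<close> y(3)] push.hyps y(3) assms(2) reduced_closed[OF y(1)]
        by (simp add: y(5) flip: H.m_assoc)
      ultimately show ?thesis
        using 3 y(2,3)
        by (intro exI[of _ "\<iota> u g \<otimes>\<^bsub>H\<^esub> y"])
          (simp add: rest_push_adj top_syllable_push_adj on_top_push_adj)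
    qed
  qed
  then show ?thesis using that by blast
qed

lemma reduced_act:
  assumes "reduced p x" "v \<in> V" "g \<in> carrier (G v)"
  shows "reduced (act v g p) (\<iota> v g \<otimes>\<^bsub>H\<^esub> x)"
proof -
  obtain y where y: "reduced (rest v p) y" "\<not> on_top v (rest v p)"
    "top_syllable v p \<in> carrier (G v)" "x = \<iota> v (top_syllable v p) \<otimes>\<^bsub>H\<^esub> y"
    using reduced_split[OF assms(1,2)] by metis
  have "g \<otimes>\<^bsub>G v\<^esub> top_syllable v p \<in> carrier (G v)"
    using y(3) assms vertex_group by (simp add: group.is_monoid monoid.m_closed)
  from reduced_put[OF y(1) assms(2) this y(2)] show ?thesis
    using y(3,4) assms reduced_closed[OF y(1)] by (simp add: act_def iota_mult H.m_assoc)
qed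

lemma exists_reduced: "x \<in> carrier H \<Longrightarrow> \<exists>p. reduced p x"
  by (induction rule: graph_product_induct) (blast intro: reduced.empty reduced_act)+

lemma act_one:
  assumes "reduced p x" "v \<in> V"
  shows "act v \<one>\<^bsub>G v\<^esub> p = p"
  using reduced_split[OF assms] vertex_group[OF assms(2)]
  by (metis act_def group.is_monoid monoid.l_one)

lemma act_mult:
  assumes "reduced p x" "v \<in> V" "g \<in> carrier (G v)" "h \<in> carrier (G v)"
  shows "act v (g \<otimes>\<^bsub>G v\<^esub> h) p = act v g (act v h p)"
proof -
  interpret v: group "G v" using vertex_group assms(2) .
  obtain y where "\<not> on_top v (rest v p)" "top_syllable v p \<in> carrier (G v)"
    using reduced_split[OF assms(1,2)] by metis
  then show ?thesis
    using assms by (simp add: act_def top_syllable_put rest_put v.m_assoc)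
qed

text \<open>The method of van der Waerden: the actions of the vertex groups on the set of pilings of reduced
  words combine to an action of the graph product, and an element with a reduced word of piling \<open>p\<close>
  sends the empty piling to \<open>p\<close>. So the element determines \<open>p\<close>.\<close>

theorem reduced_unique:
  assumes "reduced p x" "reduced q x"
  shows "p = q"
proof -
  define \<Omega> where "\<Omega> = {p. \<exists>x. reduced p x}"
  define f where "f = (\<lambda>v g. \<lambda>p\<in>\<Omega>. act v g p)"
  have act_closed: "act v g p \<in> \<Omega>" if "v \<in> V" "g \<in> carrier (G v)" "p \<in> \<Omega>" for v g p
    using that reduced_act unfolding \<Omega>_def by blast
  have act_one': "act v \<one>\<^bsub>G v\<^esub> p = p" if "v \<in> V" "p \<in> \<Omega>" for v p
    using that act_one unfolding \<Omega>_def by blast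
  have act_mult': "act v (g \<otimes>\<^bsub>G v\<^esub> h) p = act v g (act v h p)"
    if "v \<in> V" "g \<in> carrier (G v)" "h \<in> carrier (G v)" "p \<in> \<Omega>" for v g h p
    using that act_mult unfolding \<Omega>_def by blast
  have f_Bij: "f v g \<in> Bij \<Omega>" if "v \<in> V" "g \<in> carrier (G v)" for v g
  proof -
    interpret v: group "G v" using vertex_group that(1) .
    have "bij_betw (act v g) \<Omega> \<Omega>"
      using that by (intro bij_betw_byWitness[where f' = "act v (inv\<^bsub>G v\<^esub> g)"])
        (auto simp: act_closed act_one' simp flip: act_mult')
    then have "bij_betw (f v g) \<Omega> \<Omega>"
      by (rule bij_betw_cong[THEN iffD1, rotated]) (simp add: f_def)
    then show ?thesis by (simp add: Bij_def f_def)
  qed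
  have f_hom: "f v \<in> hom (G v) (BijGroup \<Omega>)" if "v \<in> V" for v
  proof (rule homI)
    show "f v g \<in> carrier (BijGroup \<Omega>)" if "g \<in> carrier (G v)" for g
      using f_Bij \<open>v \<in> V\<close> that by (simp add: BijGroup_def)
    show "f v (g \<otimes>\<^bsub>G v\<^esub> h) = f v g \<otimes>\<^bsub>BijGroup \<Omega>\<^esub> f v h"
      if "g \<in> carrier (G v)" "h \<in> carrier (G v)" for g h
      using f_Bij \<open>v \<in> V\<close> that
      by (auto simp: BijGroup_def compose_def f_def act_mult' act_closed intro!: restrict_ext)
  qed
  have f_commute: "f u g \<otimes>\<^bsub>BijGroup \<Omega>\<^esub> f v h = f v h \<otimes>\<^bsub>BijGroup \<Omega>\<^esub> f u g"
    if "(u, v) \<in> E" "g \<in> carrier (G u)" "h \<in> carrier (G v)" for u v g h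
    using that f_Bij edge_vertices[OF that(1)] act_commute[OF that(1)]
    by (auto simp: BijGroup_def compose_def f_def act_closed intro!: restrict_ext)
  obtain \<psi> where \<psi>: "\<psi> \<in> hom H (BijGroup \<Omega>)"
    "\<And>v g. \<lbrakk>v \<in> V; g \<in> carrier (G v)\<rbrakk> \<Longrightarrow> \<psi> (\<iota> v g) = f v g"
    using graph_product_universal[OF group_BijGroup f_hom f_commute] by blast
  have \<psi>_Bij: "\<psi> x \<in> Bij \<Omega>" if "x \<in> carrier H" for x
    using \<psi>(1) that by (auto simp: hom_def BijGroup_def)
  have "(\<lambda>_ _. []) \<in> \<Omega>" unfolding \<Omega>_def using reduced.empty by blast
  have orbit: "\<psi> x (\<lambda>_ _. []) = p" if "reduced p x" for p x
    using that
  proof (induction rule: reduced.induct)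
    case empty
    have "\<psi> \<one>\<^bsub>H\<^esub> = \<one>\<^bsub>BijGroup \<Omega>\<^esub>"
      by (rule hom_one[OF \<psi>(1) H.group_axioms group_BijGroup])
    then show ?case using \<open>(\<lambda>_ _. []) \<in> \<Omega>\<close> by (simp add: BijGroup_def)
  next
    case (push p x v g)
    interpret v: group "G v" using vertex_group push.hyps by blast
    have "\<psi> (\<iota> v g \<otimes>\<^bsub>H\<^esub> x) = f v g \<otimes>\<^bsub>BijGroup \<Omega>\<^esub> \<psi> x"
      using hom_mult[OF \<psi>(1)] push.hyps reduced_closed by (simp add: \<psi>(2))
    then have "\<psi> (\<iota> v g \<otimes>\<^bsub>H\<^esub> x) (\<lambda>_ _. []) = f v g p"
      using \<psi>_Bij[OF reduced_closed[OF push.hyps(1)]] f_Bij push \<open>(\<lambda>_ _. []) \<in> \<Omega>\<close>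
      by (simp add: BijGroup_def compose_def)
    also have "\<dots> = push v g p"
      using push.hyps unfolding f_def \<Omega>_def
      by (auto simp: act_def rest_def top_syllable_def put_def)
    finally show ?case .
  qed
  show ?thesis using orbit[OF assms(1)] orbit[OF assms(2)] by simp
qed


section \<open>Heads of group elements\<close>

definition piling_of :: "('v \<times> 'a) list set set \<Rightarrow> ('v, 'a) piling" where
  "piling_of x = (THE p. reduced p x)"

definition heads :: "('v \<times> 'a) list set set \<Rightarrow> 'v set" where
  "heads x = {v. on_top v (piling_of x)}"

lemma piling_of_eq: "reduced p x \<Longrightarrow> piling_of x = p"
  unfolding piling_of_def by (blast intro: reduced_unique)

lemma reduced_piling_of: "x \<in> carrier H \<Longrightarrow> reduced (piling_of x) x"
  using exists_reduced piling_of_eq by force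

lemma piling_of_one: "piling_of \<one>\<^bsub>H\<^esub> = (\<lambda>_ _. [])"
  by (rule piling_of_eq) (rule reduced.empty)

lemma heads_one [simp]: "heads \<one>\<^bsub>H\<^esub> = {}"
  unfolding heads_def piling_of_one on_top_def using no_loop by blast

lemma on_top_imp_vertex: "\<lbrakk>reduced p x; on_top v p\<rbrakk> \<Longrightarrow> v \<in> V"
proof (induction rule: reduced.induct)
  case empty
  then show ?case using no_loop[of v] unfolding on_top_def by blast
next
  case (push p x u g)
  then show ?case using not_on_top_push[of u v g p] edge_vertices[of u v] by blast
qed

lemma heads_iota_mult:
  assumes "x \<in> carrier H" "v \<in> V" "g \<in> carrier (G v)" "g \<noteq> \<one>\<^bsub>G v\<^esub>" "v \<notin> heads x"
  shows "piling_of (\<iota> v g \<otimes>\<^bsub>H\<^esub> x) = push v g (piling_of x)"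
    and "heads (\<iota> v g \<otimes>\<^bsub>H\<^esub> x) = insert v {u \<in> heads x. (v, u) \<in> E}"
proof -
  show *: "piling_of (\<iota> v g \<otimes>\<^bsub>H\<^esub> x) = push v g (piling_of x)"
    using assms by (intro piling_of_eq reduced.push reduced_piling_of) (auto simp: heads_def)
  show "heads (\<iota> v g \<otimes>\<^bsub>H\<^esub> x) = insert v {u \<in> heads x. (v, u) \<in> E}"
  proof (rule Set.set_eqI)
    fix u
    show "u \<in> heads (\<iota> v g \<otimes>\<^bsub>H\<^esub> x) \<longleftrightarrow> u \<in> insert v {u \<in> heads x. (v, u) \<in> E}"
      unfolding heads_def *
      using on_top_push_adj[of v u g "piling_of x"] not_on_top_push[of v u g "piling_of x"]
      by (cases "u = v") auto
  qed
qed

lemma heads_adjacent: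
  assumes "x \<in> carrier H" "u \<in> heads x" "v \<in> heads x" "u \<noteq> v"
  shows "(u, v) \<in> E"
proof -
  have r: "reduced (piling_of x) x" and u: "on_top u (piling_of x)" and v: "on_top v (piling_of x)"
    using assms reduced_piling_of by (auto simp: heads_def)
  have "put u (top_syllable u (piling_of x)) (rest u (piling_of x)) = piling_of x"
    and "\<not> on_top u (rest u (piling_of x))"
    using reduced_split[OF r on_top_imp_vertex[OF r u]] by metis+
  then have "push u (top_syllable u (piling_of x)) (rest u (piling_of x)) = piling_of x"
    using u by (auto simp: put_def split: if_splits)
  then show ?thesis using not_on_top_push v assms(4) by metis
qed

text \<open>Every element is built up by reduced expressions, so the induction step may assume that the new
  syllable neither merges nor cancels.\<close>

lemma graph_product_head_induct [consumes 1, case_names one mult]: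
  assumes "x \<in> carrier H"
    and "P \<one>\<^bsub>H\<^esub>"
    and "\<And>v g x. \<lbrakk>x \<in> carrier H; v \<in> V; g \<in> carrier (G v); g \<noteq> \<one>\<^bsub>G v\<^esub>; v \<notin> heads x; P x\<rbrakk>
      \<Longrightarrow> P (\<iota> v g \<otimes>\<^bsub>H\<^esub> x)"
  shows "P x"
proof -
  have "P x" if "reduced p x" for p x
    using that
  proof (induction rule: reduced.induct)
    case (push p x v g)
    then show ?case
      using assms(3) reduced_closed piling_of_eq unfolding heads_def by auto
  qed (rule assms(2))
  then show ?thesis using assms(1) reduced_piling_of by blast
qed

text \<open>This is where the distance between \<open>a\<close> and \<open>b\<close> matters. If \<open>b\<close> is a head of \<open>x\<close>, the remaining
  heads of \<open>x\<close> are neighbours of \<open>b\<close>, hence not of \<open>a\<close>, and a syllable at \<open>a\<close> put in front covers all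
  of them. Otherwise a syllable at \<open>b\<close> is put in front first to reach that situation.\<close>

lemma steer_heads:
  assumes x: "x \<in> carrier H"
    and ab: "a \<in> V" "b \<in> V" "a \<noteq> b" "(a, b) \<notin> E" "\<And>c. \<not> ((a, c) \<in> E \<and> (c, b) \<in> E)"
    and g: "g \<in> carrier (G a)" "g \<noteq> \<one>\<^bsub>G a\<^esub>" and h: "h \<in> carrier (G b)" "h \<noteq> \<one>\<^bsub>G b\<^esub>"
  shows "\<exists>d\<in>{\<iota> a g, \<iota> a g \<otimes>\<^bsub>H\<^esub> \<iota> b h}. heads (d \<otimes>\<^bsub>H\<^esub> x) = {a}"
proof (cases "b \<in> heads x")
  case True
  then have "a \<notin> heads x" using heads_adjacent[OF x] ab by blast
  moreover have "{u \<in> heads x. (a, u) \<in> E} = {}"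
    using heads_adjacent[OF x _ True] ab by blast
  ultimately have "heads (\<iota> a g \<otimes>\<^bsub>H\<^esub> x) = {a}"
    by (simp only: heads_iota_mult(2)[OF x ab(1) g] not_False_eq_True)
  then show ?thesis by blast
next
  case False
  let ?y = "\<iota> b h \<otimes>\<^bsub>H\<^esub> x"
  have y: "?y \<in> carrier H" using x ab h by simp
  have hy: "heads ?y = insert b {u \<in> heads x. (b, u) \<in> E}"
    using heads_iota_mult(2)[OF x ab(2) h False] .
  have "a \<notin> heads ?y" unfolding hy using ab edge_sym[of b a] by blast
  moreover have "{u \<in> heads ?y. (a, u) \<in> E} = {}"
    unfolding hy using ab edge_sym[of b] by blast
  ultimately have "heads (\<iota> a g \<otimes>\<^bsub>H\<^esub> ?y) = {a}"
    by (simp only: heads_iota_mult(2)[OF y ab(1) g] not_False_eq_True)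
  then show ?thesis using x ab g h by (auto simp: H.m_assoc)
qed

end

section \<open>Lengths of elements\<close>

locale syllable_length = graph_of_groups \<Gamma> G
  for \<Gamma> :: "'v pair_pre_digraph" and G :: "'v \<Rightarrow> ('a, 'b) monoid_scheme" +
  fixes len :: "'v \<Rightarrow> 'a \<Rightarrow> nat"
  assumes len_one: "v \<in> pverts \<Gamma> \<Longrightarrow> len v \<one>\<^bsub>G v\<^esub> = 0"
    and len_mult_le: "\<lbrakk>v \<in> pverts \<Gamma>; g \<in> carrier (G v); h \<in> carrier (G v)\<rbrakk>
      \<Longrightarrow> len v (g \<otimes>\<^bsub>G v\<^esub> h) \<le> len v g + len v h"
    and len_inv: "\<lbrakk>v \<in> pverts \<Gamma>; g \<in> carrier (G v)\<rbrakk> \<Longrightarrow> len v (inv\<^bsub>G v\<^esub> g) = len v g"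
begin

definition weight :: "('v, 'a) piling \<Rightarrow> nat" where
  "weight p = (\<Sum>v\<in>V. \<Sum>(_, g)\<leftarrow>p v v. len v g)"

definition norm :: "('v \<times> 'a) list set set \<Rightarrow> nat" where
  "norm x = weight (piling_of x)"

lemma weight_push: "v \<in> V \<Longrightarrow> weight (push v g p) = len v g + weight p"
proof -
  assume v: "v \<in> V"
  have "(\<Sum>u\<in>V - {v}. \<Sum>(_, g)\<leftarrow>push v g p u u. len u g) = (\<Sum>u\<in>V - {v}. \<Sum>(_, g)\<leftarrow>p u u. len u g)"
    by (rule sum.cong) (auto simp: push_def)
  then show ?thesis
    unfolding weight_def sum.remove[OF finite_vertices v] by (simp add: push_def)
qed

lemma weight_put: "v \<in> V \<Longrightarrow> weight (put v g p) = len v g + weight p"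
  by (simp add: put_def weight_push len_one)

lemma norm_one [simp]: "norm \<one>\<^bsub>H\<^esub> = 0"
  by (simp add: norm_def piling_of_one weight_def)

lemma norm_iota_mult:
  "\<lbrakk>x \<in> carrier H; v \<in> V; g \<in> carrier (G v); g \<noteq> \<one>\<^bsub>G v\<^esub>; v \<notin> heads x\<rbrakk>
    \<Longrightarrow> norm (\<iota> v g \<otimes>\<^bsub>H\<^esub> x) = len v g + norm x"
  by (simp add: norm_def heads_iota_mult(1) weight_push)

text \<open>Multiplication by a syllable may merge it with a top syllable or cancel that one, which is where
  subadditivity of \<open>len\<close> enters. In consequence the norm is a lower bound for word lengths.\<close>

lemma norm_iota_mult_le:
  assumes "x \<in> carrier H" "v \<in> V" "g \<in> carrier (G v)"
  shows "norm (\<iota> v g \<otimes>\<^bsub>H\<^esub> x) \<le> len v g + norm x"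
proof -
  define p where "p = piling_of x"
  have p: "reduced p x" unfolding p_def using assms(1) by (rule reduced_piling_of)
  obtain top: "top_syllable v p \<in> carrier (G v)" and eq: "put v (top_syllable v p) (rest v p) = p"
    using reduced_split[OF p assms(2)] by metis
  have "norm (\<iota> v g \<otimes>\<^bsub>H\<^esub> x) = weight (act v g p)"
    unfolding norm_def using piling_of_eq[OF reduced_act[OF p assms(2,3)]] by simp
  also have "\<dots> \<le> len v g + (len v (top_syllable v p) + weight (rest v p))"
    using len_mult_le[OF assms(2,3) top] assms(2) by (simp add: act_def weight_put)
  also have "len v (top_syllable v p) + weight (rest v p) = weight p"
    using weight_put[OF assms(2), of "top_syllable v p" "rest v p"] eq by simp
  finally show ?thesis by (simp add: norm_def p_def)
qed

text \<open>The syllables of \<open>s\<close> are moved one by one, inverted, to the front of \<open>t\<close>. A syllable at \<open>v\<close> meets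
  no head \<open>v\<close> of \<open>t\<close>, so that lengths add up, and the heads stay disjoint: a head common to the
  remainder of \<open>s\<close> and the new \<open>t\<close> is not \<open>v\<close>, as the expression of \<open>s\<close> is reduced, so it would be a
  neighbour of \<open>v\<close> and hence already a head of both \<open>s\<close> and \<open>t\<close>.\<close>

lemma norm_inv_mult:
  assumes "s \<in> carrier H" "t \<in> carrier H" "heads s \<inter> heads t = {}"
  shows "norm (inv\<^bsub>H\<^esub> s \<otimes>\<^bsub>H\<^esub> t) = norm s + norm t"
  using assms
proof (induction arbitrary: t rule: graph_product_head_induct)
  case one
  then show ?case by simp
next
  case (mult v g s)
  interpret v: group "G v" using vertex_group mult.hyps by blast
  have ig: "inv\<^bsub>G v\<^esub> g \<in> carrier (G v)" "inv\<^bsub>G v\<^esub> g \<noteq> \<one>\<^bsub>G v\<^esub>"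
    using mult.hyps v.inv_eq_1_iff by auto
  have hs: "heads (\<iota> v g \<otimes>\<^bsub>H\<^esub> s) = insert v {u \<in> heads s. (v, u) \<in> E}"
    using mult.hyps by (intro heads_iota_mult(2)) auto
  let ?t = "\<iota> v (inv\<^bsub>G v\<^esub> g) \<otimes>\<^bsub>H\<^esub> t"
  have vt: "v \<notin> heads t" using hs mult.prems by auto
  have t: "?t \<in> carrier H" using mult ig by simp
  have "heads ?t = insert v {u \<in> heads t. (v, u) \<in> E}"
    using mult.hyps mult.prems ig vt by (intro heads_iota_mult(2)) auto
  then have "heads s \<inter> heads ?t = {}" using hs mult.hyps mult.prems by auto
  then have "norm (inv\<^bsub>H\<^esub> s \<otimes>\<^bsub>H\<^esub> ?t) = norm s + norm ?t" using mult.IH t by blast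
  moreover have "inv\<^bsub>H\<^esub> s \<otimes>\<^bsub>H\<^esub> ?t = inv\<^bsub>H\<^esub> (\<iota> v g \<otimes>\<^bsub>H\<^esub> s) \<otimes>\<^bsub>H\<^esub> t"
    using mult.hyps mult.prems by (simp add: iota_inv H.inv_mult_group H.m_assoc)
  moreover have "norm ?t = len v g + norm t"
    using norm_iota_mult[OF mult.prems(1) \<open>v \<in> V\<close> ig vt] mult.hyps by (simp add: len_inv)
  moreover have "norm (\<iota> v g \<otimes>\<^bsub>H\<^esub> s) = len v g + norm s"
    using mult.hyps by (simp add: norm_iota_mult)
  ultimately show ?case by simp
qed

end

section \<open>Geodesic words\<close>

locale marked_graph_product = graph_of_groups \<Gamma> G
  for \<Gamma> :: "'v pair_pre_digraph" and G :: "'v \<Rightarrow> ('a, 'b) monoid_scheme" +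
  fixes Y :: "'v \<Rightarrow> 'y set"
    and \<phi> :: "('v, 'y) letter list \<Rightarrow> ('v \<times> 'a) list set set"
  assumes phi_hom: "\<phi> \<in> hom (free_monoid (alphabet (pverts \<Gamma>) Y)) (graph_product \<Gamma> G)"
    and phi_Nil [simp]: "\<phi> [] = \<one>\<^bsub>graph_product \<Gamma> G\<^esub>"
    and phi_generate: "v \<in> pverts \<Gamma> \<Longrightarrow>
      generate (graph_product \<Gamma> G) ((\<lambda>y. \<phi> [Gen v y]) ` Y v) = vertex_subgroup \<Gamma> G v"
    and phi_inv_letter: "x \<in> alphabet (pverts \<Gamma>) Y \<Longrightarrow>
      \<phi> [inv_letter x] = inv\<^bsub>graph_product \<Gamma> G\<^esub> (\<phi> [x])"
begin

abbreviation "X \<equiv> alphabet V Y"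

lemma phi_closed: "w \<in> lists X \<Longrightarrow> \<phi> w \<in> carrier H"
  using phi_hom by (auto simp: hom_def free_monoid_def)

lemma phi_append: "\<lbrakk>u \<in> lists X; w \<in> lists X\<rbrakk> \<Longrightarrow> \<phi> (u @ w) = \<phi> u \<otimes>\<^bsub>H\<^esub> \<phi> w"
  using phi_hom by (auto simp: hom_def free_monoid_def)

lemma vertex_lists: "v \<in> V \<Longrightarrow> w \<in> lists (alphabet {v} Y) \<Longrightarrow> w \<in> lists X"
  by (auto simp: alphabet_def)

lemma inv_letter_closed: "x \<in> alphabet U Y \<Longrightarrow> inv_letter x \<in> alphabet U Y"
  by (cases x) (auto simp: alphabet_def image_iff)

lemma phi_inv_word: "w \<in> lists X \<Longrightarrow> \<phi> (rev (map inv_letter w)) = inv\<^bsub>H\<^esub> \<phi> w"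
proof (induction w)
  case Nil
  then show ?case by simp
next
  case (Cons x w)
  have "\<phi> (rev (map inv_letter w) @ [inv_letter x]) = inv\<^bsub>H\<^esub> \<phi> w \<otimes>\<^bsub>H\<^esub> inv\<^bsub>H\<^esub> \<phi> [x]"
    using Cons by (subst phi_append) (auto simp: phi_inv_letter inv_letter_closed)
  also have "\<dots> = inv\<^bsub>H\<^esub> (\<phi> [x] \<otimes>\<^bsub>H\<^esub> \<phi> w)"
    using Cons.prems phi_closed by (subst H.inv_mult_group) auto
  also have "\<phi> [x] \<otimes>\<^bsub>H\<^esub> \<phi> w = \<phi> (x # w)"
    using phi_append[of "[x]" w] Cons.prems by auto
  finally show ?case by simp
qed

lemma vertex_word_exists:
  assumes v: "v \<in> V" and g: "g \<in> carrier (G v)"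
  shows "\<exists>w\<in>lists (alphabet {v} Y). \<phi> w = \<iota> v g"
proof -
  have gen: "Gen v y \<in> alphabet {v} Y" "Inv_Gen v y \<in> alphabet {v} Y" if "y \<in> Y v" for y
    using that by (auto simp: alphabet_def)
  have "\<exists>w\<in>lists (alphabet {v} Y). \<phi> w = x"
    if "x \<in> generate H ((\<lambda>y. \<phi> [Gen v y]) ` Y v)" for x
    using that
  proof (induction rule: generate.induct)
    case one
    show ?case by (rule bexI[of _ "[]"]) auto
  next
    case (incl x)
    then obtain y where "y \<in> Y v" "x = \<phi> [Gen v y]" by blast
    then show ?case using gen by (intro bexI[of _ "[Gen v y]"]) auto
  next
    case (inv x)
    then obtain y where y: "y \<in> Y v" "x = \<phi> [Gen v y]" by blast
    have "\<phi> [Inv_Gen v y] = inv\<^bsub>H\<^esub> x"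
      using phi_inv_letter[of "Gen v y"] y v by (auto simp: alphabet_def)
    then show ?case using gen y by (intro bexI[of _ "[Inv_Gen v y]"]) auto
  next
    case (eng x y)
    then obtain u w where "u \<in> lists (alphabet {v} Y)" "\<phi> u = x"
      "w \<in> lists (alphabet {v} Y)" "\<phi> w = y" by blast
    then show ?case using phi_append vertex_lists[OF v] by (intro bexI[of _ "u @ w"]) auto
  qed
  then show ?thesis using phi_generate[OF v] g unfolding vertex_subgroup_def by auto
qed

text \<open>Only words over the letters of \<open>v\<close> compete here. That detours through other vertex groups
  do not help is part of the characterisation of geodesics below.\<close>

definition vertex_len :: "'v \<Rightarrow> 'a \<Rightarrow> nat" where
  "vertex_len v g = (LEAST n. \<exists>w\<in>lists (alphabet {v} Y). \<phi> w = \<iota> v g \<and> length w = n)"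

lemma vertex_len_word:
  assumes "v \<in> V" "g \<in> carrier (G v)"
  obtains w where "w \<in> lists (alphabet {v} Y)" "\<phi> w = \<iota> v g" "length w = vertex_len v g"
proof -
  have "\<exists>n. \<exists>w\<in>lists (alphabet {v} Y). \<phi> w = \<iota> v g \<and> length w = n"
    using vertex_word_exists[OF assms] by blast
  from LeastI_ex[OF this] show ?thesis using that unfolding vertex_len_def by blast
qed

lemma vertex_len_le:
  "\<lbrakk>w \<in> lists (alphabet {v} Y); \<phi> w = \<iota> v g\<rbrakk> \<Longrightarrow> vertex_len v g \<le> length w"
  unfolding vertex_len_def by (rule Least_le) blast

lemma vertex_len_inv_le:
  assumes "v \<in> V" "g \<in> carrier (G v)"
  shows "vertex_len v (inv\<^bsub>G v\<^esub> g) \<le> vertex_len v g"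
proof -
  obtain w where w: "w \<in> lists (alphabet {v} Y)" "\<phi> w = \<iota> v g" "length w = vertex_len v g"
    using vertex_len_word[OF assms] .
  have "rev (map inv_letter w) \<in> lists (alphabet {v} Y)"
    using w(1) inv_letter_closed[of _ "{v}"] by auto
  moreover have "\<phi> (rev (map inv_letter w)) = \<iota> v (inv\<^bsub>G v\<^esub> g)"
    using phi_inv_word[OF vertex_lists[OF assms(1) w(1)]] assms w(2) by (simp add: iota_inv)
  ultimately have "vertex_len v (inv\<^bsub>G v\<^esub> g) \<le> length (rev (map inv_letter w))"
    by (rule vertex_len_le)
  then show ?thesis using w(3) by simp
qed

sublocale syllable_length \<Gamma> G vertex_len
proof
  fix v assume v: "v \<in> V"
  interpret v: group "G v" using vertex_group v .
  show "vertex_len v \<one>\<^bsub>G v\<^esub> = 0" using vertex_len_le[of "[]" v "\<one>\<^bsub>G v\<^esub>"] v by simp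
  fix g assume g: "g \<in> carrier (G v)"
  show "vertex_len v (inv\<^bsub>G v\<^esub> g) = vertex_len v g"
    using vertex_len_inv_le[OF v g] vertex_len_inv_le[OF v v.inv_closed[OF g]] g by simp
  fix h assume h: "h \<in> carrier (G v)"
  obtain u w where "u \<in> lists (alphabet {v} Y)" "\<phi> u = \<iota> v g" "length u = vertex_len v g"
    and "w \<in> lists (alphabet {v} Y)" "\<phi> w = \<iota> v h" "length w = vertex_len v h"
    using vertex_len_word[OF v g] vertex_len_word[OF v h] by metis
  then show "vertex_len v (g \<otimes>\<^bsub>G v\<^esub> h) \<le> vertex_len v g + vertex_len v h"
    using vertex_len_le[of "u @ w" v "g \<otimes>\<^bsub>G v\<^esub> h"] vertex_lists[OF v] v g h
    by (simp add: phi_append iota_mult)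
qed

lemma letter_in_vertex_group:
  assumes "x \<in> X"
  obtains v g where "v \<in> V" "g \<in> carrier (G v)" "\<phi> [x] = \<iota> v g" "vertex_len v g \<le> 1"
proof -
  obtain v where v: "v \<in> V" "x \<in> alphabet {v} Y"
    using assms by (auto simp: alphabet_def)
  then consider y where "y \<in> Y v" "x = Gen v y" | y where "y \<in> Y v" "x = Inv_Gen v y"
    by (auto simp: alphabet_def)
  then have "\<phi> [x] \<in> generate H ((\<lambda>y. \<phi> [Gen v y]) ` Y v)"
  proof cases
    case 1
    then show ?thesis by (auto intro: generate.incl)
  next
    case 2
    then have "\<phi> [x] = inv\<^bsub>H\<^esub> \<phi> [Gen v y]"
      using phi_inv_letter[of "Gen v y"] v by (auto simp: alphabet_def)
    then show ?thesis using 2 by (auto intro: generate.inv)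
  qed
  then obtain g where g: "g \<in> carrier (G v)" "\<phi> [x] = \<iota> v g"
    using phi_generate[OF v(1)] unfolding vertex_subgroup_def by auto
  moreover have "vertex_len v g \<le> 1" using vertex_len_le[of "[x]" v g] v g by simp
  ultimately show ?thesis using that v by blast
qed

lemma norm_le_length: "w \<in> lists X \<Longrightarrow> norm (\<phi> w) \<le> length w"
proof (induction w)
  case Nil
  then show ?case by simp
next
  case (Cons x w)
  obtain v g where vg: "v \<in> V" "g \<in> carrier (G v)" "\<phi> [x] = \<iota> v g" "vertex_len v g \<le> 1"
    using letter_in_vertex_group[of x] Cons.prems by auto
  have "\<phi> (x # w) = \<iota> v g \<otimes>\<^bsub>H\<^esub> \<phi> w"
    using phi_append[of "[x]" w] Cons.prems vg by simp
  then show ?case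
    using norm_iota_mult_le[of "\<phi> w" v g] phi_closed[of w] vg Cons by simp
qed

lemma norm_word_exists:
  assumes "x \<in> carrier H"
  shows "\<exists>w\<in>lists X. \<phi> w = x \<and> length w = norm x"
  using assms
proof (induction rule: graph_product_head_induct)
  case one
  show ?case by (rule bexI[of _ "[]"]) auto
next
  case (mult v g x)
  then obtain w where w: "w \<in> lists X" "\<phi> w = x" "length w = norm x" by blast
  obtain u where u: "u \<in> lists X" "\<phi> u = \<iota> v g" "length u = vertex_len v g"
    using vertex_len_word[of v g] vertex_lists[of v] mult.hyps by metis
  show ?case
    using u w mult.hyps by (intro bexI[of _ "u @ w"]) (auto simp: phi_append norm_iota_mult)
qed

text \<open>The norm is the word length: each letter changes it by at most one, and spelling out the syllables
  of a reduced expression by shortest words of the vertex groups attains it.\<close>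

lemma geodesic_iff: "w \<in> geodesics X \<phi> \<longleftrightarrow> w \<in> lists X \<and> length w = norm (\<phi> w)"
proof (cases "w \<in> lists X")
  case True
  obtain u where u: "u \<in> lists X" "\<phi> u = \<phi> w" "length u = norm (\<phi> w)"
    using norm_word_exists[OF phi_closed[OF True]] by blast
  have minimal: "norm (\<phi> w) \<le> length u'" if "u' \<in> lists X" "\<phi> u' = \<phi> w" for u'
    using norm_le_length[OF that(1)] that(2) by simp
  have "(\<exists>u'\<in>lists X. \<phi> u' = \<phi> w \<and> length u' < length w) \<longleftrightarrow> norm (\<phi> w) < length w"
  proof
    assume "\<exists>u'\<in>lists X. \<phi> u' = \<phi> w \<and> length u' < length w"
    then show "norm (\<phi> w) < length w" using minimal by (meson le_less_trans)
  next
    assume "norm (\<phi> w) < length w"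
    then show "\<exists>u'\<in>lists X. \<phi> u' = \<phi> w \<and> length u' < length w"
      using u by (intro bexI[of _ u]) simp_all
  qed
  then show ?thesis
    using True norm_le_length[OF True] unfolding geodesics_def by (auto simp only: mem_Collect_eq)
qed (auto simp: geodesics_def)

lemma geodesic_append:
  assumes "u \<in> geodesics X \<phi>" "w \<in> geodesics X \<phi>" "heads (inv\<^bsub>H\<^esub> \<phi> u) \<inter> heads (\<phi> w) = {}"
  shows "u @ w \<in> geodesics X \<phi>"
proof -
  have u: "u \<in> lists X" "length u = norm (\<phi> u)" and w: "w \<in> lists X" "length w = norm (\<phi> w)"
    using assms by (auto simp: geodesic_iff)
  have c: "\<phi> u \<in> carrier H" "\<phi> w \<in> carrier H" using u w phi_closed by auto
  have "norm (\<phi> u) = norm (inv\<^bsub>H\<^esub> \<phi> u)"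
    using norm_inv_mult[of "inv\<^bsub>H\<^esub> \<phi> u" "\<one>\<^bsub>H\<^esub>"] c by simp
  moreover have "norm (\<phi> u \<otimes>\<^bsub>H\<^esub> \<phi> w) = norm (inv\<^bsub>H\<^esub> \<phi> u) + norm (\<phi> w)"
    using norm_inv_mult[of "inv\<^bsub>H\<^esub> \<phi> u" "\<phi> w"] c assms(3) by simp
  ultimately show ?thesis
    using u w by (simp add: geodesic_iff phi_append)
qed

lemma geodesic_exists: "x \<in> carrier H \<Longrightarrow> \<exists>w\<in>geodesics X \<phi>. \<phi> w = x"
  using norm_word_exists geodesic_iff by metis

end

section \<open>Left orders and regular positive cones\<close>

lemma (in group) finite_upper_bound:
  assumes r: "left_order G r" and "finite A" "A \<subseteq> carrier G"
  shows "\<exists>b\<in>carrier G. \<forall>a\<in>A. (a, b) \<in> r"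
  using assms(2,3)
proof (induction A rule: finite_induct)
  case empty
  then show ?case by blast
next
  case (insert a A)
  then obtain b where b: "b \<in> carrier G" "\<forall>x\<in>A. (x, b) \<in> r" by blast
  have lin: "total_on (carrier G) r" "refl_on (carrier G) r" "trans r"
    using r unfolding left_order_def linear_order_on_def partial_order_on_def preorder_on_def by auto
  show ?case
  proof (cases "(a, b) \<in> r")
    case True
    then show ?thesis using b by blast
  next
    case False
    have a: "a \<in> carrier G" using insert.prems by blast
    then have refl: "(a, a) \<in> r" using lin(2) by (rule refl_onD[rotated])
    with False have "(b, a) \<in> r"
      using lin(1) a b(1) unfolding total_on_def by metis
    then have "(x, a) \<in> r" if "x \<in> A" for x
      using b(2) that transD[OF lin(3)] by blast
    with a refl show ?thesis by blast
  qed
qed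

text \<open>Choose \<open>b\<close> above all the elements \<open>d\<inverse> x\<close>. By left invariance every \<open>d b\<close> is above \<open>x\<close>, and one of
  them lies in \<open>U\<close>.\<close>

lemma (in group) finite_translates_cofinal:
  assumes r: "left_order G r" and "finite D" "D \<subseteq> carrier G"
    and U: "\<And>y. y \<in> carrier G \<Longrightarrow> \<exists>d\<in>D. d \<otimes> y \<in> U"
    and x: "x \<in> carrier G"
  shows "\<exists>s\<in>U. (x, s) \<in> r"
proof -
  obtain b where b: "b \<in> carrier G" "\<forall>d\<in>D. (inv d \<otimes> x, b) \<in> r"
    using finite_upper_bound[OF r, of "(\<lambda>d. inv d \<otimes> x) ` D"] assms(2,3) x by auto
  obtain d where d: "d \<in> D" "d \<otimes> b \<in> U" using U[OF b(1)] by blast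
  have "d \<in> carrier G" using d assms(3) by blast
  then have "(d \<otimes> (inv d \<otimes> x), d \<otimes> b) \<in> r"
    using r b d x unfolding left_order_def by simp
  moreover have "d \<otimes> (inv d \<otimes> x) = x"
    using \<open>d \<in> carrier G\<close> x by (simp flip: m_assoc)
  ultimately have "(x, d \<otimes> b) \<in> r" by simp
  then show ?thesis using d(2) by blast
qed

lemma (in group) positive_inv_mult_iff:
  assumes r: "left_order G r" and s: "s \<in> carrier G" and t: "t \<in> carrier G"
  shows "positive_element G r (inv s \<otimes> t) \<longleftrightarrow> (s, t) \<in> r \<and> s \<noteq> t"
proof -
  have mono: "(h \<otimes> g, h \<otimes> g') \<in> r" if "(g, g') \<in> r" "g \<in> carrier G" "g' \<in> carrier G" "h \<in> carrier G" for g g' h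
    using r that unfolding left_order_def by blast
  have eq: "s \<otimes> (inv s \<otimes> t) = t" using s t by (simp flip: m_assoc)
  have "(\<one>, inv s \<otimes> t) \<in> r \<longleftrightarrow> (s, t) \<in> r"
    using mono[of \<one> "inv s \<otimes> t" s] mono[of s t "inv s"] s t eq by auto
  moreover have "inv s \<otimes> t = \<one> \<longleftrightarrow> s = t"
    using s t eq by auto
  ultimately show ?thesis unfolding positive_element_def by blast
qed

text \<open>For every state that occurs on some \<open>u s\<close>, choose a representative \<open>s'\<close> in \<open>S\<close> and an element \<open>\<tau> s'\<close>
  of \<open>T\<close> above it. An element \<open>s\<close> of \<open>S\<close> above these finitely many elements shares its state with some
  \<open>s'\<close>, and so \<open>\<tau> s'\<close> would have to be above \<open>s\<close> as well.\<close>

lemma (in group) positive_cone_not_regular: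
  assumes r: "left_order G r"
    and app: "\<And>u w. \<lbrakk>u \<in> lists X; w \<in> lists X\<rbrakk> \<Longrightarrow> \<phi> (u @ w) = \<phi> u \<otimes> \<phi> w"
    and S: "S \<subseteq> carrier G" "\<And>x. x \<in> carrier G \<Longrightarrow> \<exists>s\<in>S. (x, s) \<in> r"
    and T: "T \<subseteq> carrier G" "\<And>x. x \<in> carrier G \<Longrightarrow> \<exists>t\<in>T. (x, t) \<in> r"
    and "S \<inter> T = {}"
    and u: "\<And>s. s \<in> S \<Longrightarrow> \<phi> (u s) = inv s"
    and w: "\<And>t. t \<in> T \<Longrightarrow> \<phi> (w t) = t"
    and geo: "\<And>s t. \<lbrakk>s \<in> S; t \<in> T\<rbrakk> \<Longrightarrow> u s @ w t \<in> geodesics X \<phi>"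
  shows "\<not> regular_language X (positive_cone_language X \<phi> G r)"
proof (rule notI, unfold regular_language_def, elim exE conjE)
  let ?L = "positive_cone_language X \<phi> G r"
  fix Q :: "nat set" and q0 \<delta> A
  assume Q: "finite Q" "q0 \<in> Q" "\<forall>q\<in>Q. \<forall>x\<in>X. \<delta> q x \<in> Q"
    and L: "?L = {w \<in> lists X. foldl \<delta> q0 w \<in> A}"
  have lin: "antisym r" "trans r"
    using r unfolding left_order_def linear_order_on_def partial_order_on_def preorder_on_def by auto
  have foldl_Q: "foldl \<delta> q v \<in> Q" if "q \<in> Q" "v \<in> lists X" for q v
    using that Q(3) by (induction v arbitrary: q) auto
  have lists: "u s \<in> lists X" "w t \<in> lists X" if "s \<in> S" "t \<in> T" for s t
    using geo[OF that] by (auto simp: geodesics_def)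
  define \<sigma> where "\<sigma> s = foldl \<delta> q0 (u s)" for s
  have accept: "(s, t) \<in> r \<longleftrightarrow> foldl \<delta> (\<sigma> s) (w t) \<in> A" if "s \<in> S" "t \<in> T" for s t
  proof -
    have "u s @ w t \<in> ?L \<longleftrightarrow> (s, t) \<in> r \<and> s \<noteq> t"
    proof -
      have "\<phi> (u s @ w t) = inv s \<otimes> t"
        by (simp only: app[OF lists[OF that]] u[OF that(1)] w[OF that(2)])
      moreover have "s \<in> carrier G" "t \<in> carrier G" using that S(1) T(1) by blast+
      ultimately show ?thesis
        using geo[OF that] positive_inv_mult_iff[OF r, of s t]
        by (simp only: positive_cone_language_def mem_Collect_eq simp_thms)
    qed
    moreover have "s \<noteq> t" using that \<open>S \<inter> T = {}\<close> by blast
    ultimately show ?thesis using lists[OF that] by (simp add: L \<sigma>_def)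
  qed
  obtain t0 where "t0 \<in> T" using T(2)[of \<one>] by auto
  have "\<sigma> s \<in> Q" if "s \<in> S" for s
    unfolding \<sigma>_def using Q(2) lists(1)[OF that \<open>t0 \<in> T\<close>] by (rule foldl_Q)
  then have "finite (\<sigma> ` S)"
    by (intro finite_subset[OF _ Q(1)] image_subsetI)
  then obtain S' where S': "S' \<subseteq> S" "finite S'" "\<sigma> ` S = \<sigma> ` S'"
    using finite_subset_image[of "\<sigma> ` S" \<sigma> S] by auto
  have "\<forall>s\<in>S'. \<exists>t\<in>T. (s, t) \<in> r" using T(2) S'(1) S(1) by blast
  then obtain \<tau> where \<tau>: "\<And>s. s \<in> S' \<Longrightarrow> \<tau> s \<in> T \<and> (s, \<tau> s) \<in> r" by metis
  obtain b where b: "b \<in> carrier G" "\<forall>t\<in>\<tau> ` S'. (t, b) \<in> r"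
  proof -
    have "finite (\<tau> ` S')" "\<tau> ` S' \<subseteq> carrier G" using S'(2) \<tau> T(1) by auto
    then show ?thesis using finite_upper_bound[OF r] that by blast
  qed
  obtain s where s: "s \<in> S" "(b, s) \<in> r" using S(2)[OF b(1)] by blast
  obtain s' where s': "s' \<in> S'" "\<sigma> s' = \<sigma> s" using S'(3) s(1) by (metis imageE imageI)
  have t: "\<tau> s' \<in> T" "(s', \<tau> s') \<in> r" using \<tau>[OF s'(1)] by auto
  have "s' \<in> S" using s'(1) S'(1) by blast
  then have "(s, \<tau> s') \<in> r" using accept t s(1) s'(2) by simp
  moreover have "(\<tau> s', s) \<in> r" using transD[OF lin(2) _ s(2)] b(2) s'(1) by blast
  ultimately have "s = \<tau> s'" by (rule antisymD[OF lin(1)])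
  then show False using s(1) t(1) \<open>S \<inter> T = {}\<close> by blast
qed

section \<open>Graphs of diameter at least 3\<close>

text \<open>The supremum in the diameter exceeds 2, so some pair of vertices has distance greater than 2. The
  distance may be infinite; it is enough that there is no walk of length at most 2.\<close>

lemma far_apart_vertices:
  assumes "pair_graph \<Gamma>" "graph_diameter \<Gamma> \<ge> 3"
  obtains a b where "a \<in> pverts \<Gamma>" "b \<in> pverts \<Gamma>" "a \<noteq> b" "(a, b) \<notin> parcs \<Gamma>"
    "\<And>c. \<not> ((a, c) \<in> parcs \<Gamma> \<and> (c, b) \<in> parcs \<Gamma>)"
proof -
  interpret pair_graph \<Gamma> by (rule assms(1))
  have "(2::ereal) < 3" by simp
  also have "\<dots> \<le> (SUP (u, v) \<in> pverts \<Gamma> \<times> pverts \<Gamma>. graph_dist \<Gamma> u v)"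
    using assms(2) by (simp add: graph_diameter_def)
  finally obtain a b where ab: "a \<in> pverts \<Gamma>" "b \<in> pverts \<Gamma>" "2 < graph_dist \<Gamma> a b"
    by (auto simp: less_SUP_iff)
  have long: "\<not> length p \<le> 2" if "awalk a p b" for p
  proof
    assume "length p \<le> 2"
    then have "awalk_cost (\<lambda>_. 1) p \<le> 2" by (simp add: awalk_cost_def sum_list_triv)
    then have "graph_dist \<Gamma> a b \<le> 2"
      using min_cost_le_walk_cost[OF that, of "\<lambda>_. 1"] unfolding graph_dist_def
      by (metis dual_order.trans ereal_less_eq(3) numeral_eq_ereal)
    then show False using ab(3) by simp
  qed
  have "a \<noteq> b" using long[of "[]"] ab by (auto simp: awalk_Nil_iff)
  moreover have "(a, b) \<notin> parcs \<Gamma>"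
    using long[of "[(a, b)]"] ab by (auto simp: awalk_Cons_iff awalk_Nil_iff)
  moreover have "\<not> ((a, c) \<in> parcs \<Gamma> \<and> (c, b) \<in> parcs \<Gamma>)" for c
    using long[of "[(a, c), (c, b)]"] ab by (auto simp: awalk_Cons_iff awalk_Nil_iff)
  ultimately show ?thesis using that ab by blast
qed

theorem theorem4:
  fixes \<Gamma> :: "'v pair_pre_digraph"
    and G :: "'v \<Rightarrow> ('a, 'b) monoid_scheme"
    and Y :: "'v \<Rightarrow> 'y set"
    and \<phi> :: "('v, 'y) letter list \<Rightarrow> ('v \<times> 'a) list set set"
  assumes "pair_graph \<Gamma>"
    and "graph_diameter \<Gamma> \<ge> 3"
    and "\<And>v. v \<in> pverts \<Gamma> \<Longrightarrow> group (G v)"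
    and "\<And>v. v \<in> pverts \<Gamma> \<Longrightarrow> carrier (G v) \<noteq> {\<one>\<^bsub>G v\<^esub>}"
    and "\<And>v. v \<in> pverts \<Gamma> \<Longrightarrow> orderable (G v)"
    and "\<And>v. v \<in> pverts \<Gamma> \<Longrightarrow> finite (Y v)"
    and "\<phi> \<in> hom (free_monoid (alphabet (pverts \<Gamma>) Y)) (graph_product \<Gamma> G)"
    and "\<phi> [] = \<one>\<^bsub>graph_product \<Gamma> G\<^esub>"
    and "\<And>v. v \<in> pverts \<Gamma> \<Longrightarrow>
      generate (graph_product \<Gamma> G) ((\<lambda>y. \<phi> [Gen v y]) ` Y v) = vertex_subgroup \<Gamma> G v"
    and "\<And>x. x \<in> alphabet (pverts \<Gamma>) Y \<Longrightarrow>
      \<phi> [inv_letter x] = inv\<^bsub>graph_product \<Gamma> G\<^esub> (\<phi> [x])"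
  shows "\<not> (\<exists>r. left_order (graph_product \<Gamma> G) r \<and>
      regular_language (alphabet (pverts \<Gamma>) Y)
        (positive_cone_language (alphabet (pverts \<Gamma>) Y) \<phi> (graph_product \<Gamma> G) r))"
proof -
  interpret marked_graph_product \<Gamma> G Y \<phi>
    by (intro marked_graph_product.intro graph_of_groups.intro marked_graph_product_axioms.intro)
      (fact assms)+
  obtain a b where ab: "a \<in> V" "b \<in> V" "a \<noteq> b" "(a, b) \<notin> E"
    "\<And>c. \<not> ((a, c) \<in> E \<and> (c, b) \<in> E)"
    using far_apart_vertices[OF assms(1,2)] by metis
  have ba: "b \<noteq> a" "(b, a) \<notin> E" "\<And>c. \<not> ((b, c) \<in> E \<and> (c, a) \<in> E)"
    using ab edge_sym by blast+
  obtain g h where g: "g \<in> carrier (G a)" "g \<noteq> \<one>\<^bsub>G a\<^esub>" and h: "h \<in> carrier (G b)" "h \<noteq> \<one>\<^bsub>G b\<^esub>"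
    using assms(4)[OF ab(1)] assms(4)[OF ab(2)] one_closed[OF ab(1)] one_closed[OF ab(2)] by blast
  define S where "S c = {x \<in> carrier H. heads x = {c}}" for c
  obtain \<gamma> where \<gamma>: "\<And>x. x \<in> carrier H \<Longrightarrow> \<gamma> x \<in> geodesics X \<phi> \<and> \<phi> (\<gamma> x) = x"
    using geodesic_exists by metis
  have "\<not> regular_language X (positive_cone_language X \<phi> H r)" if r: "left_order H r" for r
  proof (rule H.positive_cone_not_regular[OF r, of X \<phi> "S a" "S b" "\<lambda>s. \<gamma> (inv\<^bsub>H\<^esub> s)" \<gamma>])
    show "\<exists>s\<in>S a. (x, s) \<in> r" if "x \<in> carrier H" for x
    proof (rule H.finite_translates_cofinal[OF r _ _ _ that])
      show "\<exists>d\<in>{\<iota> a g, \<iota> a g \<otimes>\<^bsub>H\<^esub> \<iota> b h}. d \<otimes>\<^bsub>H\<^esub> y \<in> S a" if "y \<in> carrier H" for y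
        using steer_heads[OF that ab g h] that ab g h by (auto simp: S_def)
    qed (use ab g h in auto)
    show "\<exists>t\<in>S b. (x, t) \<in> r" if "x \<in> carrier H" for x
    proof (rule H.finite_translates_cofinal[OF r _ _ _ that])
      show "\<exists>d\<in>{\<iota> b h, \<iota> b h \<otimes>\<^bsub>H\<^esub> \<iota> a g}. d \<otimes>\<^bsub>H\<^esub> y \<in> S b" if "y \<in> carrier H" for y
        using steer_heads[OF that ab(2,1) ba h g] that ab g h by (auto simp: S_def)
    qed (use ab g h in auto)
    show "\<gamma> (inv\<^bsub>H\<^esub> s) @ \<gamma> t \<in> geodesics X \<phi>" if "s \<in> S a" "t \<in> S b" for s t
      using that \<gamma> ab(3) by (intro geodesic_append) (auto simp: S_def)
  qed (use \<gamma> ab(3) in \<open>auto simp: S_def phi_append\<close>)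
  then show ?thesis by blast
qed

end
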